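(* Running on $G\in\mathbb{N}$, the algorithm COUNT (described in the context) returns the values of $n_g$ for $g\le G$ in time $$O\left(\log(G)\times G\times\sum_{g=0}^{G} n_g\right)$$ and its space complexity is $O(\log(G)\times G^3)$.
   Context: Here $\mathbb{N}=\{0,1,2,\dots\}$. A numerical semigroup is a subset $S\subseteq\mathbb{N}$ containing $0$, closed under addition, with finite complement in $\mathbb{N}$. Its genus is $g(S)=\operatorname{card}(\mathbb{N}\setminus S)$, its multiplicity is $m(S)=\min(S\setminus\{0\})$ and its conductor is $c(S)=1+\max(\mathbb{Z}\setminus S)$. For each $g$, the finite number of numerical semigroups of genus $g$ is denoted $n_g$. A non-zero element of $S$ is irreducible if it is not a sum of two non-zero elements of $S$. For irreducible $x$, $S^x=S\setminus\{x\}$ is again a numerical semigroup. For $x\in\mathbb{N}$, the decomposition number is $d_S(x)=\operatorname{card}\{y\in S : x-y\in S,\ 2y\le x\}$; for $x\neq 0$, $x$ is irreducible in $S$ if and only if $d_S(x)=1$. Representation: for a fixed $G$, a semigroup $S$ of genus at most $G$ is stored as S.c $=c(S)$, S.g $=g(S)$, S.m $=m(S)$ and the array S.d with S.d[i] $=d_S(i)$ for $0\le i\le 3G$. ROOT(G) returns the representation R of $\mathbb{N}$: R.c $=0$, R.g $=0$, R.m $=1$, and R.d[x] $=1+\lfloor x/2\rfloor$ for $0\le x\le 3G$. SON(S,x,G), for $x$ irreducible in $S$ with $x\ge c(S)$, returns the representation T of $S^x$ as follows: T.c $\gets x+1$; T.g $\gets$ S.g $+1$; T.m $\gets$ S.m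 if $x>$ S.m, and T.m $\gets$ S.m $+1$ otherwise; T.d $\gets$ S.d (copy of the whole array); then for $y$ from $x$ to $3G$, if S.d[$y-x$] $>0$, set T.d[$y$] $\gets$ S.d[$y$] $-1$. COUNT(G): initialize an array n indexed by $0,\dots,G$ to zeros (n[g] stands for $n_g$), create an empty stack and push ROOT(G) on it. While the stack is not empty: let S be the top of the stack and pop it; increase n[S.g] by $1$; if S.g $<G$, then for each $x$ from S.c to S.c $+$ S.m (both included) with $x\neq 0$ and S.d[$x$] $=1$, push SON(S,x,G) on the stack. When the stack is empty, return n. (This is a depth-first exploration of the tree whose root is $\mathbb{N}$ and in which the sons of $S$ are the $S^x$ with $x$ irreducible and $x\ge c(S)$.) Complexity convention: the bounds are asymptotic in $G$; an elementary step on an integer bounded by a constant multiple of $G$ costs time $O(\log G)$ and storing such an integer costs space $O(\log G)$. *)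

theory Defs
  imports "HOL-Library.Landau_Symbols"
begin

section \<open>Numerical semigroups\<close>

definition numerical_semigroup :: "nat set \<Rightarrow> bool" where
  "numerical_semigroup S \<longleftrightarrow>
     0 \<in> S \<and> (\<forall>a\<in>S. \<forall>b\<in>S. a + b \<in> S) \<and> finite (- S)"

definition genus :: "nat set \<Rightarrow> nat" where
  "genus S = card (- S)"

definition num_semigroups :: "nat \<Rightarrow> nat" where
  "num_semigroups g = card {S. numerical_semigroup S \<and> genus S = g}"


section \<open>The programming language\<close>

text \<open>
  A small imperative language over natural numbers, in which the algorithm is written.
  Its memory consists of finitely many integer variables, finitely many integer arrays, and one
  stack of semigroup representations. A representation variable \<open>R\<close> (\<open>RegS\<close> or \<open>RegT\<close>)
  occupies the integer variables \<open>Fc R\<close>, \<open>Fg R\<close>, \<open>Fm R\<close> and the array \<open>Fd R\<close>.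
\<close>

datatype reg = RegS | RegT

datatype vname = VG | VX | VY | Fc reg | Fg reg | Fm reg

datatype aname = Cnt | Fd reg

instance reg :: finite
proof
  have "(UNIV :: reg set) = {RegS, RegT}"
    using reg.exhaust by auto
  then show "finite (UNIV :: reg set)"
    by (metis finite.emptyI finite.insertI)
qed

instance vname :: finite
proof
  have "(UNIV :: vname set) = {VG, VX, VY} \<union> range Fc \<union> range Fg \<union> range Fm"
  proof (intro set_eqI iffI UNIV_I)
    fix v :: vname
    show "v \<in> {VG, VX, VY} \<union> range Fc \<union> range Fg \<union> range Fm"
      by (cases v) auto
  qed
  then show "finite (UNIV :: vname set)"
    by (metis finite.emptyI finite.insertI finite_UnI finite_imageI finite_class.finite_UNIV)
qed

instance aname :: finite
proof
  have "(UNIV :: aname set) = {Cnt} \<union> range Fd"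
  proof (intro set_eqI iffI UNIV_I)
    fix a :: aname
    show "a \<in> {Cnt} \<union> range Fd"
      by (cases a) auto
  qed
  then show "finite (UNIV :: aname set)"
    by (metis finite.emptyI finite.insertI finite_UnI finite_imageI finite_class.finite_UNIV)
qed

datatype aexp =
    Num nat
  | Var vname
  | Get aname aexp
  | Plus aexp aexp
  | Minus aexp aexp
  | Half aexp

datatype bexp =
    Leq aexp aexp
  | Equal aexp aexp
  | Neg bexp
  | Conj bexp bexp
  | StackEmpty

datatype com =
    SKIP
  | Assign vname aexp           ("_ ::= _" [900, 61] 61)
  | Store aname aexp aexp       ("_\<langle>_\<rangle> ::= _" [900, 0, 61] 61)
  | New aname aexp
  | Copy aname aname
  | ClearStack
  | Push reg
  | Pop reg
  | Seq com com                 ("_;;/ _" [60, 61] 60)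
  | Cond bexp com com             ("(IF _/ THEN _/ ELSE _)" [0, 0, 61] 61)
  | While bexp com              ("(WHILE _/ DO _)" [0, 61] 61)

abbreviation For :: "vname \<Rightarrow> aexp \<Rightarrow> aexp \<Rightarrow> com \<Rightarrow> com"
    ("(FOR _/ FROM _/ TO _/ DO _)" [0, 0, 0, 61] 61) where
  "FOR v FROM e1 TO e2 DO c \<equiv>
     v ::= e1;; WHILE Leq (Var v) e2 DO (c;; v ::= Plus (Var v) (Num 1))"

datatype rep = Rep (rc: nat) (rg: nat) (rm: nat) (rd: "nat list")

definition rep_ints :: "rep \<Rightarrow> nat list" where
  "rep_ints R = [rc R, rg R, rm R] @ rd R"

record state =
  vars :: "vname \<Rightarrow> nat"
  arrs :: "aname \<Rightarrow> nat list"
  stack :: "rep list"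

definition get_rep :: "reg \<Rightarrow> state \<Rightarrow> rep" where
  "get_rep r s = Rep (vars s (Fc r)) (vars s (Fg r)) (vars s (Fm r)) (arrs s (Fd r))"

definition set_rep :: "reg \<Rightarrow> rep \<Rightarrow> state \<Rightarrow> state" where
  "set_rep r R s =
     s\<lparr>vars := (vars s)(Fc r := rc R, Fg r := rg R, Fm r := rm R),
       arrs := (arrs s)(Fd r := rd R)\<rparr>"

primrec aval :: "aexp \<Rightarrow> state \<Rightarrow> nat" where
  "aval (Num n) s = n"
| "aval (Var v) s = vars s v"
| "aval (Get a e) s = arrs s a ! aval e s"
| "aval (Plus e1 e2) s = aval e1 s + aval e2 s"
| "aval (Minus e1 e2) s = aval e1 s - aval e2 s"
| "aval (Half e) s = aval e s div 2"

primrec bval :: "bexp \<Rightarrow> state \<Rightarrow> bool" where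
  "bval (Leq e1 e2) s \<longleftrightarrow> aval e1 s \<le> aval e2 s"
| "bval (Equal e1 e2) s \<longleftrightarrow> aval e1 s = aval e2 s"
| "bval (Neg b) s \<longleftrightarrow> \<not> bval b s"
| "bval (Conj b1 b2) s \<longleftrightarrow> bval b1 s \<and> bval b2 s"
| "bval StackEmpty s \<longleftrightarrow> stack s = []"

text \<open>Array accesses within bounds; execution gets stuck on any other access.\<close>

primrec asafe :: "aexp \<Rightarrow> state \<Rightarrow> bool" where
  "asafe (Num n) s \<longleftrightarrow> True"
| "asafe (Var v) s \<longleftrightarrow> True"
| "asafe (Get a e) s \<longleftrightarrow> asafe e s \<and> aval e s < length (arrs s a)"
| "asafe (Plus e1 e2) s \<longleftrightarrow> asafe e1 s \<and> asafe e2 s"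
| "asafe (Minus e1 e2) s \<longleftrightarrow> asafe e1 s \<and> asafe e2 s"
| "asafe (Half e) s \<longleftrightarrow> asafe e s"

primrec bsafe :: "bexp \<Rightarrow> state \<Rightarrow> bool" where
  "bsafe (Leq e1 e2) s \<longleftrightarrow> asafe e1 s \<and> asafe e2 s"
| "bsafe (Equal e1 e2) s \<longleftrightarrow> asafe e1 s \<and> asafe e2 s"
| "bsafe (Neg b) s \<longleftrightarrow> bsafe b s"
| "bsafe (Conj b1 b2) s \<longleftrightarrow> bsafe b1 s \<and> bsafe b2 s"
| "bsafe StackEmpty s \<longleftrightarrow> True"


section \<open>Time and space\<close>

text \<open>
  The integers produced while evaluating an expression, one for each read or arithmetic operation.
  A comparison is accounted for by its operands. Testing the stack for emptiness inspects its height.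
\<close>

primrec avals :: "aexp \<Rightarrow> state \<Rightarrow> nat list" where
  "avals (Num n) s = [n]"
| "avals (Var v) s = [vars s v]"
| "avals (Get a e) s = avals e s @ [aval (Get a e) s]"
| "avals (Plus e1 e2) s = avals e1 s @ avals e2 s @ [aval (Plus e1 e2) s]"
| "avals (Minus e1 e2) s = avals e1 s @ avals e2 s @ [aval (Minus e1 e2) s]"
| "avals (Half e) s = avals e s @ [aval (Half e) s]"

primrec bvals :: "bexp \<Rightarrow> state \<Rightarrow> nat list" where
  "bvals (Leq e1 e2) s = avals e1 s @ avals e2 s"
| "bvals (Equal e1 e2) s = avals e1 s @ avals e2 s"
| "bvals (Neg b) s = bvals b s"
| "bvals (Conj b1 b2) s = bvals b1 s @ bvals b2 s"
| "bvals StackEmpty s = [length (stack s)]"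

definition cost :: "(nat \<Rightarrow> nat) \<Rightarrow> nat list \<Rightarrow> nat" where
  "cost w xs = (\<Sum>x\<leftarrow>xs. w x)"

definition mem :: "(nat \<Rightarrow> nat) \<Rightarrow> state \<Rightarrow> nat" where
  "mem w s =
     (\<Sum>v\<in>UNIV. w (vars s v)) + (\<Sum>a\<in>UNIV. cost w (arrs s a)) +
     w (length (stack s)) + (\<Sum>R\<leftarrow>stack s. cost w (rep_ints R))"

text \<open>
  Peak memory of a single step from \<open>s\<close> to \<open>s'\<close> which needs the integers \<open>tmp\<close> as temporaries.
\<close>

definition peak :: "(nat \<Rightarrow> nat) \<Rightarrow> state \<Rightarrow> nat list \<Rightarrow> state \<Rightarrow> nat" where
  "peak w s tmp s' = max (mem w s + cost w tmp) (mem w s')"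

text \<open>
  \<open>exec tc sc c s t m s'\<close>: started in \<open>s\<close>, the program \<open>c\<close> terminates in \<open>s'\<close> after time \<open>t\<close>, the
  largest amount of memory occupied at any moment being \<open>m\<close>. An elementary step on the integer \<open>n\<close>
  takes time \<open>tc n\<close>, and storing \<open>n\<close> takes space \<open>sc n\<close>. Whenever a whole array is initialized or
  transferred, every cell is paid for, through its index and its contents; stack operations also pay
  for the height of the stack. Since \<open>tc\<close> and \<open>sc\<close> are applied to the actual integers, the counters
  in \<open>Cnt\<close>, which are not bounded by a multiple of \<open>G\<close>, are paid for according to their size. An
  elementary step on integers bounded by a multiple of \<open>G\<close> costs \<open>O(log G)\<close> precisely when
  \<open>tc n\<close> is \<open>O(log n)\<close>, and likewise for \<open>sc\<close>.
\<close>

inductive exec ::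
    "(nat \<Rightarrow> nat) \<Rightarrow> (nat \<Rightarrow> nat) \<Rightarrow> com \<Rightarrow> state \<Rightarrow> nat \<Rightarrow> nat \<Rightarrow> state \<Rightarrow> bool"
  for tc sc where
  Skip:
    "exec tc sc SKIP s 0 (mem sc s) s"
| Assign:
    "asafe e s \<Longrightarrow> s' = s\<lparr>vars := (vars s)(v := aval e s)\<rparr> \<Longrightarrow>
     exec tc sc (v ::= e) s
       (cost tc (avals e s @ [aval e s])) (peak sc s (avals e s) s') s'"
| Store:
    "asafe i s \<Longrightarrow> asafe e s \<Longrightarrow> aval i s < length (arrs s a) \<Longrightarrow>
     s' = s\<lparr>arrs := (arrs s)(a := (arrs s a)[aval i s := aval e s])\<rparr> \<Longrightarrow>
     exec tc sc (a\<langle>i\<rangle> ::= e) s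
       (cost tc (avals i s @ avals e s @ [aval e s])) (peak sc s (avals i s @ avals e s) s') s'"
| New:
    "asafe e s \<Longrightarrow> s' = s\<lparr>arrs := (arrs s)(a := replicate (aval e s) 0)\<rparr> \<Longrightarrow>
     exec tc sc (New a e) s
       (cost tc (avals e s @ [0..<aval e s] @ replicate (aval e s) 0))
       (peak sc s (avals e s) s') s'"
| Copy:
    "s' = s\<lparr>arrs := (arrs s)(a := arrs s b)\<rparr> \<Longrightarrow>
     exec tc sc (Copy a b) s
       (cost tc ([0..<length (arrs s b)] @ arrs s b)) (peak sc s [] s') s'"
| ClearStack:
    "s' = s\<lparr>stack := []\<rparr> \<Longrightarrow>
     exec tc sc ClearStack s (cost tc [0]) (peak sc s [] s') s'"
| Push:
    "R = get_rep r s \<Longrightarrow> s' = s\<lparr>stack := R # stack s\<rparr> \<Longrightarrow>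
     exec tc sc (Push r) s
       (cost tc (length (stack s) # [0..<length (rd R)] @ rep_ints R)) (peak sc s [] s') s'"
| Pop:
    "stack s = R # Rs \<Longrightarrow> s' = (set_rep r R s)\<lparr>stack := Rs\<rparr> \<Longrightarrow>
     exec tc sc (Pop r) s
       (cost tc (length (stack s) # [0..<length (rd R)] @ rep_ints R)) (peak sc s [] s') s'"
| Seq:
    "exec tc sc c1 s1 t1 m1 s2 \<Longrightarrow> exec tc sc c2 s2 t2 m2 s3 \<Longrightarrow>
     exec tc sc (c1;; c2) s1 (t1 + t2) (max m1 m2) s3"
| IfTrue:
    "bsafe b s \<Longrightarrow> bval b s \<Longrightarrow> exec tc sc c1 s t m s' \<Longrightarrow>
     exec tc sc (IF b THEN c1 ELSE c2) s
       (cost tc (bvals b s) + t) (max (peak sc s (bvals b s) s) m) s'"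
| IfFalse:
    "bsafe b s \<Longrightarrow> \<not> bval b s \<Longrightarrow> exec tc sc c2 s t m s' \<Longrightarrow>
     exec tc sc (IF b THEN c1 ELSE c2) s
       (cost tc (bvals b s) + t) (max (peak sc s (bvals b s) s) m) s'"
| WhileFalse:
    "bsafe b s \<Longrightarrow> \<not> bval b s \<Longrightarrow>
     exec tc sc (WHILE b DO c) s (cost tc (bvals b s)) (peak sc s (bvals b s) s) s"
| WhileTrue:
    "bsafe b s1 \<Longrightarrow> bval b s1 \<Longrightarrow> exec tc sc c s1 t1 m1 s2 \<Longrightarrow>
     exec tc sc (WHILE b DO c) s2 t2 m2 s3 \<Longrightarrow>
     exec tc sc (WHILE b DO c) s1
       (cost tc (bvals b s1) + t1 + t2) (max (peak sc s1 (bvals b s1) s1) (max m1 m2)) s3"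

text \<open>
  Execution is deterministic, so a program has at most one result, running time and peak memory.
\<close>

lemma exec_deterministic:
  assumes "exec tc sc c s t m s'" and "exec tc sc c s t2 m2 s2"
  shows "t2 = t \<and> m2 = m \<and> s2 = s'"
  using assms
proof (induction arbitrary: t2 m2 s2 rule: exec.induct)
  case (Seq c1 s1 t1 m1 s2' c2 t2' m2' s3)
  from Seq.prems show ?case
    by (cases rule: exec.cases) (use Seq.IH in blast)+
next
  case (IfTrue b s c1 t m s' c2)
  from IfTrue.prems show ?case
    by (cases rule: exec.cases) (use IfTrue.IH IfTrue.hyps in blast)+
next
  case (IfFalse b s c2 t m s' c1)
  from IfFalse.prems show ?case
    by (cases rule: exec.cases) (use IfFalse.IH IfFalse.hyps in blast)+
next
  case (WhileFalse b s c)
  from WhileFalse.prems show ?case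
    by (cases rule: exec.cases) (use WhileFalse.hyps in blast)+
next
  case (WhileTrue b s1 c t1 m1 s2' t2' m2' s3)
  from WhileTrue.prems show ?case
    by (cases rule: exec.cases) (use WhileTrue.IH WhileTrue.hyps in blast)+
qed (erule exec.cases; simp; fail)+


section \<open>The algorithm\<close>

text \<open>
  The input \<open>G\<close> is the variable \<open>VG\<close>, and the result is the array \<open>Cnt\<close>. \<open>RegS\<close> holds the
  semigroup last popped from the stack, and \<open>RegT\<close> the result of \<open>ROOT\<close> or \<open>SON\<close> to be pushed.
\<close>

abbreviation (input) ThreeG :: aexp where
  "ThreeG \<equiv> Plus (Var VG) (Plus (Var VG) (Var VG))"

definition ROOT :: "reg \<Rightarrow> com" where
  "ROOT R =
     Fc R ::= Num 0;;
     Fg R ::= Num 0;;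
     Fm R ::= Num 1;;
     New (Fd R) (Plus ThreeG (Num 1));;
     FOR VX FROM Num 0 TO ThreeG DO
       (Fd R)\<langle>Var VX\<rangle> ::= Plus (Num 1) (Half (Var VX))"

definition SON :: "reg \<Rightarrow> vname \<Rightarrow> reg \<Rightarrow> com" where
  "SON S x T =
     Fc T ::= Plus (Var x) (Num 1);;
     Fg T ::= Plus (Var (Fg S)) (Num 1);;
     (IF Neg (Leq (Var x) (Var (Fm S)))
      THEN Fm T ::= Var (Fm S)
      ELSE Fm T ::= Plus (Var (Fm S)) (Num 1));;
     Copy (Fd T) (Fd S);;
     FOR VY FROM Var x TO ThreeG DO
       (IF Neg (Equal (Get (Fd S) (Minus (Var VY) (Var x))) (Num 0))
        THEN (Fd T)\<langle>Var VY\<rangle> ::= Minus (Get (Fd S) (Var VY)) (Num 1)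
        ELSE SKIP)"

definition COUNT :: com where
  "COUNT =
     New Cnt (Plus (Var VG) (Num 1));;
     ClearStack;;
     ROOT RegT;;
     Push RegT;;
     WHILE Neg StackEmpty DO
       (Pop RegS;;
        Cnt\<langle>Var (Fg RegS)\<rangle> ::= Plus (Get Cnt (Var (Fg RegS))) (Num 1);;
        (IF Neg (Leq (Var VG) (Var (Fg RegS)))
         THEN
           FOR VX FROM Var (Fc RegS) TO Plus (Var (Fc RegS)) (Var (Fm RegS)) DO
             (IF Conj (Neg (Equal (Var VX) (Num 0))) (Equal (Get (Fd RegS) (Var VX)) (Num 1))
              THEN SON RegS VX RegT;; Push RegT
              ELSE SKIP)
         ELSE SKIP))"

definition init_state :: "nat \<Rightarrow> state" where
  "init_state G = \<lparr>vars = (\<lambda>_. 0)(VG := G), arrs = (\<lambda>_. []), stack = []\<rparr>"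

end

theory Submission
  imports Defs
begin

text \<open>
  The sons of a semigroup \<open>S\<close> arise by removing an irreducible element \<open>x \<ge> c(S)\<close>. Such a removal
  changes only elements from \<open>c(S)\<close> on and makes \<open>x + 1\<close> the new conductor. Hence the semigroups
  below \<open>S\<close> in the tree are exactly the semigroups contained in \<open>S\<close> that agree with \<open>S\<close> below
  \<open>c(S)\<close>, and each of them other than \<open>S\<close> itself lies below one son only
  (\<open>card_descendants_sons\<close>). For the root this says that every semigroup occurs exactly once in the tree.
  Decomposition numbers recognize the irreducible elements (\<open>decomposition_number_eq_1_iff\<close>), and
  removing \<open>x\<close> lowers the decomposition number of \<open>y\<close> by one precisely when \<open>y - x\<close> is an element
  (\<open>decomposition_number_remove\<close>), which is what \<open>SON\<close> computes. A semigroup of genus \<open>g < G\<close> has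
  \<open>c \<le> 2 * g\<close> and \<open>m \<le> g + 1\<close>, so that all candidates \<open>x \<le> c + m\<close> lie within the stored range up
  to \<open>3 * G\<close>.

  Time: constructing and pushing a son, as well as popping a semigroup and scanning its candidates,
  takes \<open>O(G)\<close> elementary steps on integers that are polynomial in \<open>G\<close>. The first cost is charged to
  the son and the second to the popped semigroup, so each semigroup of genus at most \<open>G\<close> is charged
  \<open>O(G * log G)\<close> (\<open>runs_traversal\<close>). A counter may be as large as \<open>4 ^ G\<close>, but it is touched only
  once per visit, at a cost of \<open>O(G)\<close>.

  Space: along the stack, from the top down, the genus never increases, and a given genus occurs at
  most \<open>G + 1\<close> times, because semigroups of a new largest genus enter only as the sons of one
  semigroup (\<open>pending_step\<close>). The stack thus holds \<open>O(G ^ 2)\<close> representations of \<open>O(G)\<close> integers of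
  size \<open>O(log G)\<close> each. The counters occupy \<open>O(G ^ 2)\<close> and are negligible.
\<close>


section \<open>Conductor, multiplicity and decomposition numbers\<close>

definition conductor :: "nat set \<Rightarrow> nat" where
  "conductor S = (LEAST c. \<forall>x\<ge>c. x \<in> S)"

definition multiplicity :: "nat set \<Rightarrow> nat" where
  "multiplicity S = (LEAST x. x \<in> S \<and> x \<noteq> 0)"

definition decompositions :: "nat set \<Rightarrow> nat \<Rightarrow> nat set" where
  "decompositions S x = {y \<in> S. x - y \<in> S \<and> 2 * y \<le> x}"

definition decomposition_number :: "nat set \<Rightarrow> nat \<Rightarrow> nat" where
  "decomposition_number S x = card (decompositions S x)"

definition irreducible_in :: "nat set \<Rightarrow> nat \<Rightarrow> bool" where
  "irreducible_in S x \<longleftrightarrow> x \<in> S \<and> x \<noteq> 0 \<and> (\<forall>a\<in>S - {0}. \<forall>b\<in>S - {0}. x \<noteq> a + b)"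

lemma numerical_semigroupD:
  assumes "numerical_semigroup S"
  shows "0 \<in> S" "a \<in> S \<Longrightarrow> b \<in> S \<Longrightarrow> a + b \<in> S" "finite (- S)"
  using assms by (auto simp: numerical_semigroup_def)

lemma mem_if_conductor_le:
  assumes "numerical_semigroup S" "conductor S \<le> x"
  shows "x \<in> S"
proof -
  obtain b where "\<forall>y\<in>- S. y < b"
    using numerical_semigroupD(3)[OF assms(1)] finite_nat_set_iff_bounded by blast
  then have "\<forall>x\<ge>b. x \<in> S"
    by (meson ComplI leD)
  then have "\<forall>x\<ge>conductor S. x \<in> S"
    unfolding conductor_def by (rule LeastI)
  with assms(2) show ?thesis
    by blast
qed

lemma conductor_minus_1_gap:
  assumes "numerical_semigroup S" "0 < conductor S"
  shows "conductor S - 1 \<notin> S"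
proof
  assume gap: "conductor S - 1 \<in> S"
  have "\<forall>x\<ge>conductor S - 1. x \<in> S"
  proof (intro allI impI)
    fix x assume "conductor S - 1 \<le> x"
    then consider "x = conductor S - 1" | "conductor S \<le> x"
      by linarith
    then show "x \<in> S"
      using gap mem_if_conductor_le[OF assms(1)] by cases auto
  qed
  then have "conductor S \<le> conductor S - 1"
    unfolding conductor_def by (rule Least_le)
  with assms(2) show False
    by simp
qed

text \<open>
  If \<open>f\<close> is the largest gap, then \<open>i\<close> and \<open>f - i\<close> are never both elements, so at least half of
  the \<open>f + 1\<close> numbers up to \<open>f\<close> are gaps.
\<close>

lemma conductor_le_genus:
  assumes "numerical_semigroup S"
  shows "conductor S \<le> 2 * genus S"
proof (cases "conductor S = 0")
  case False
  define f where "f = conductor S - 1"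
  have "f \<notin> S"
    using conductor_minus_1_gap[OF assms] False by (simp add: f_def)
  have "{..f} \<subseteq> (- S) \<union> (\<lambda>i. f - i) ` (- S)"
  proof
    fix i assume "i \<in> {..f}"
    then have "f = i + (f - i)" "i = f - (f - i)"
      by auto
    then have "i \<notin> S \<or> f - i \<notin> S"
      using \<open>f \<notin> S\<close> numerical_semigroupD(2)[OF assms] by metis
    with \<open>i = f - (f - i)\<close> show "i \<in> (- S) \<union> (\<lambda>i. f - i) ` (- S)"
      by blast
  qed
  then have "card {..f} \<le> card ((- S) \<union> (\<lambda>i. f - i) ` (- S))"
    using numerical_semigroupD(3)[OF assms] by (intro card_mono) auto
  also have "\<dots> \<le> card (- S) + card (- S)"
    using card_Un_le[of "- S" "(\<lambda>i. f - i) ` (- S)"] card_image_le[of "- S" "\<lambda>i. f - i"]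
      numerical_semigroupD(3)[OF assms]
    by linarith
  finally show ?thesis
    by (simp add: f_def genus_def)
qed simp

lemma multiplicity_in:
  assumes "numerical_semigroup S"
  shows "multiplicity S \<in> S" "multiplicity S \<noteq> 0"
proof -
  have "conductor S + 1 \<in> S \<and> conductor S + 1 \<noteq> 0"
    using mem_if_conductor_le[OF assms] by simp
  then have "multiplicity S \<in> S \<and> multiplicity S \<noteq> 0"
    unfolding multiplicity_def by (rule LeastI)
  then show "multiplicity S \<in> S" "multiplicity S \<noteq> 0"
    by simp_all
qed

lemma multiplicity_le: "x \<in> S \<Longrightarrow> x \<noteq> 0 \<Longrightarrow> multiplicity S \<le> x"
  unfolding multiplicity_def by (simp add: Least_le)

lemma multiplicity_le_genus:
  assumes "numerical_semigroup S"
  shows "multiplicity S \<le> genus S + 1"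
proof -
  have "{1..<multiplicity S} \<subseteq> - S"
    using multiplicity_le by fastforce
  then have "card {1..<multiplicity S} \<le> genus S"
    unfolding genus_def using numerical_semigroupD(3)[OF assms] by (rule card_mono[rotated])
  then show ?thesis
    by simp
qed

text \<open>
  The gaps of a semigroup of genus \<open>g\<close> lie below \<open>2 * g\<close>, so they form one of \<open>4 ^ g\<close> sets. This
  is what keeps the size of the counters linear in \<open>G\<close>.
\<close>

lemma
  shows finite_semigroups_of_genus: "finite {S. numerical_semigroup S \<and> genus S = g}"
    and num_semigroups_le: "num_semigroups g \<le> 4 ^ g"
proof -
  let ?A = "{S. numerical_semigroup S \<and> genus S = g}"
  have sub: "uminus ` ?A \<subseteq> Pow {..<2 * g}"
  proof (intro subsetI PowI; elim imageE; clarify)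
    fix S x assume S: "numerical_semigroup S" "x \<notin> S" "g = genus S"
    then show "x < 2 * genus S"
      using mem_if_conductor_le[OF S(1)] conductor_le_genus[OF S(1)] by (meson le_trans not_le)
  qed
  have inj: "inj_on uminus ?A"
    by (auto simp: inj_on_def)
  show "finite ?A"
    using finite_subset[OF sub] finite_imageD[OF _ inj] by simp
  have "num_semigroups g = card (uminus ` ?A)"
    unfolding num_semigroups_def using card_image[OF inj] by simp
  also have "\<dots> \<le> card (Pow {..<2 * g})"
    using sub by (intro card_mono) auto
  also have "\<dots> = 4 ^ g"
    by (simp add: card_Pow power_mult)
  finally show "num_semigroups g \<le> 4 ^ g" .
qed

lemma finite_decompositions: "finite (decompositions S x)"
  by (rule finite_subset[of _ "{..x}"]) (auto simp: decompositions_def)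

lemma decomposition_number_pos_iff:
  assumes "numerical_semigroup S"
  shows "0 < decomposition_number S x \<longleftrightarrow> x \<in> S"
proof -
  have "decompositions S x \<noteq> {} \<longleftrightarrow> x \<in> S"
  proof
    assume "decompositions S x \<noteq> {}"
    then obtain y where "y \<in> S" "x - y \<in> S" "2 * y \<le> x"
      by (auto simp: decompositions_def)
    then show "x \<in> S"
      using numerical_semigroupD(2)[OF assms, of y "x - y"] by simp
  next
    assume "x \<in> S"
    then have "0 \<in> decompositions S x"
      using numerical_semigroupD(1)[OF assms] by (simp add: decompositions_def)
    then show "decompositions S x \<noteq> {}"
      by blast
  qed
  then show ?thesis
    by (simp add: decomposition_number_def card_gt_0_iff finite_decompositions)
qed

text \<open>
  A decomposition \<open>x = a + b\<close> is counted at its smaller summand, and the trivial one at 0. Hence 0 is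
  the only element counted precisely when there is no decomposition into non-zero elements.
\<close>

lemma decomposition_number_eq_1_iff:
  assumes "numerical_semigroup S" "x \<noteq> 0"
  shows "decomposition_number S x = 1 \<longleftrightarrow> irreducible_in S x"
proof
  assume "decomposition_number S x = 1"
  then have "x \<in> S"
    using decomposition_number_pos_iff[OF assms(1), of x] by simp
  then have 0: "0 \<in> decompositions S x"
    using numerical_semigroupD(1)[OF assms(1)] by (simp add: decompositions_def)
  have only: "y = 0" if "y \<in> decompositions S x" for y
    using \<open>decomposition_number S x = 1\<close> 0 that
    by (auto simp: decomposition_number_def card_1_singleton_iff)
  have "x \<noteq> a + b" if ab: "a \<in> S - {0}" "b \<in> S - {0}" for a b
  proof
    assume "x = a + b"
    with ab have "min a b \<in> decompositions S x"
      by (auto simp: decompositions_def min_def)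
    with only[OF this] ab show False
      by (auto simp: min_def split: if_splits)
  qed
  with \<open>x \<in> S\<close> assms(2) show "irreducible_in S x"
    by (auto simp: irreducible_in_def)
next
  assume irr: "irreducible_in S x"
  have "decompositions S x = {0}"
  proof (intro equalityI subsetI)
    fix y assume y: "y \<in> decompositions S x"
    show "y \<in> {0}"
    proof (rule ccontr)
      assume "y \<notin> {0}"
      with y have "y \<in> S - {0}" "x - y \<in> S - {0}" "x = y + (x - y)"
        by (auto simp: decompositions_def)
      with irr show False
        unfolding irreducible_in_def by blast
    qed
  qed (use irr numerical_semigroupD(1)[OF assms(1)] in
      \<open>auto simp: decompositions_def irreducible_in_def\<close>)
  then show "decomposition_number S x = 1"
    by (simp add: decomposition_number_def)
qed

lemma decomposition_number_le: "decomposition_number S x \<le> x + 1"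
proof -
  have "decomposition_number S x \<le> card {..x}"
    unfolding decomposition_number_def by (rule card_mono) (auto simp: decompositions_def)
  then show ?thesis
    by simp
qed

text \<open>
  Beyond \<open>c + m\<close>, subtracting the multiplicity leaves a non-zero element, so nothing is irreducible
  there.
\<close>

lemma irreducible_le:
  assumes "numerical_semigroup S" "irreducible_in S x"
  shows "x \<le> conductor S + multiplicity S"
proof (rule ccontr)
  assume less: "\<not> ?thesis"
  then have "x - multiplicity S \<in> S - {0}"
    using mem_if_conductor_le[OF assms(1), of "x - multiplicity S"] by simp
  moreover have "multiplicity S \<in> S - {0}"
    using multiplicity_in[OF assms(1)] by simp
  moreover have "x = (x - multiplicity S) + multiplicity S"
    using less by simp
  ultimately show False
    using assms(2) unfolding irreducible_in_def by blast
qed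


section \<open>Removing an irreducible element\<close>

lemma numerical_semigroup_remove:
  assumes "numerical_semigroup S" "irreducible_in S x"
  shows "numerical_semigroup (S - {x})"
proof -
  have "a + b \<in> S - {x}" if "a \<in> S - {x}" "b \<in> S - {x}" for a b
  proof (cases "a = 0 \<or> b = 0")
    case False
    then have "x \<noteq> a + b"
      using assms(2) that by (auto simp: irreducible_in_def)
    then show ?thesis
      using that numerical_semigroupD(2)[OF assms(1), of a b] by simp
  qed (use that in auto)
  moreover have "- (S - {x}) = insert x (- S)"
    by auto
  ultimately show ?thesis
    using assms by (auto simp: numerical_semigroup_def irreducible_in_def)
qed

lemma genus_remove:
  assumes "numerical_semigroup S" "irreducible_in S x"
  shows "genus (S - {x}) = genus S + 1"
proof -
  have "- (S - {x}) = insert x (- S)"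
    by auto
  with assms show ?thesis
    by (simp add: genus_def numerical_semigroupD irreducible_in_def)
qed

lemma conductor_remove:
  assumes "numerical_semigroup S" "conductor S \<le> x"
  shows "conductor (S - {x}) = x + 1"
  unfolding conductor_def
proof (rule Least_equality)
  show "\<forall>y\<ge>x + 1. y \<in> S - {x}"
    using mem_if_conductor_le[OF assms(1)] assms(2) by auto
  show "x + 1 \<le> c" if "\<forall>y\<ge>c. y \<in> S - {x}" for c
    using that by (metis DiffD2 insertI1 not_less_eq_eq Suc_eq_plus1)
qed

lemma multiplicity_remove:
  assumes "numerical_semigroup S" "irreducible_in S x" "conductor S \<le> x"
  shows "multiplicity (S - {x}) = (if x > multiplicity S then multiplicity S else multiplicity S + 1)"
proof (cases "x > multiplicity S")
  case True
  have "(LEAST y. y \<in> S - {x} \<and> y \<noteq> 0) = multiplicity S"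
    using multiplicity_in[OF assms(1)] multiplicity_le True by (intro Least_equality) auto
  with True show ?thesis
    by (simp add: multiplicity_def)
next
  case False
  then have x: "x = multiplicity S"
    using multiplicity_le[of x S] assms(2) by (auto simp: irreducible_in_def)
  have "(LEAST y. y \<in> S - {x} \<and> y \<noteq> 0) = x + 1"
  proof (rule Least_equality)
    show "x + 1 \<in> S - {x} \<and> x + 1 \<noteq> 0"
      using mem_if_conductor_le[OF assms(1), of "x + 1"] assms(3) by simp
    show "x + 1 \<le> y" if "y \<in> S - {x} \<and> y \<noteq> 0" for y
    proof -
      from that have "y \<noteq> x" "x \<le> y"
        using multiplicity_le[of y S] x by auto
      then show ?thesis
        by simp
    qed
  qed
  with x False show ?thesis
    by (simp add: multiplicity_def)
qed

text \<open>
  Removing \<open>x\<close> destroys the unordered pairs that contain \<open>x\<close>. The only pair with sum \<open>y\<close> that can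
  contain it is \<open>{x, y - x}\<close>, and this is a decomposition of \<open>y\<close> precisely when \<open>y - x\<close> is an element.
\<close>

lemma decomposition_number_remove:
  assumes "x \<in> S"
  shows "decomposition_number (S - {x}) y =
    (if x \<le> y \<and> y - x \<in> S then decomposition_number S y - 1 else decomposition_number S y)"
proof (cases "x \<le> y \<and> y - x \<in> S")
  case True
  then have "decompositions (S - {x}) y = decompositions S y - {min x (y - x)}"
    by (auto simp: decompositions_def min_def)
  moreover have "min x (y - x) \<in> decompositions S y"
    using True assms by (auto simp: decompositions_def min_def)
  ultimately show ?thesis
    using True by (simp add: decomposition_number_def)
next
  case False
  then have "decompositions (S - {x}) y = decompositions S y"
    using assms by (auto simp: decompositions_def)
  with False show ?thesis
    by (metis decomposition_number_def)
qed

lemma numerical_semigroup_UNIV: "numerical_semigroup UNIV"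
  by (simp add: numerical_semigroup_def)

lemma genus_UNIV: "genus UNIV = 0"
  by (simp add: genus_def)

lemma conductor_UNIV: "conductor UNIV = 0"
  by (simp add: conductor_def)

lemma multiplicity_UNIV: "multiplicity UNIV = 1"
  unfolding multiplicity_def by (rule Least_equality) auto

lemma decomposition_number_UNIV: "decomposition_number UNIV x = 1 + x div 2"
proof -
  have "decompositions UNIV x = {..x div 2}"
    by (auto simp: decompositions_def)
  then show ?thesis
    by (simp add: decomposition_number_def)
qed


section \<open>The tree of numerical semigroups\<close>

text \<open>
  The nodes of genus \<open>g\<close> in the subtree rooted at \<open>S\<close>, described without reference to the tree: all
  removals below \<open>S\<close> concern elements from the conductor of \<open>S\<close> on.
\<close>

definition descendants :: "nat set \<Rightarrow> nat \<Rightarrow> nat set set" where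
  "descendants S g =
     {T. numerical_semigroup T \<and> genus T = g \<and> T \<subseteq> S \<and> (\<forall>x\<in>S. x < conductor S \<longrightarrow> x \<in> T)}"

definition effective_generators :: "nat set \<Rightarrow> nat list" where
  "effective_generators S =
     filter (\<lambda>x. x \<noteq> 0 \<and> decomposition_number S x = 1)
       [conductor S..<Suc (conductor S + multiplicity S)]"

lemma set_effective_generators:
  assumes "numerical_semigroup S"
  shows "set (effective_generators S) = {x. irreducible_in S x \<and> conductor S \<le> x}"
proof -
  have "x \<noteq> 0 \<and> decomposition_number S x = 1 \<longleftrightarrow> irreducible_in S x" for x
    using decomposition_number_eq_1_iff[OF assms, of x] by (auto simp: irreducible_in_def)
  then show ?thesis
    using irreducible_le[OF assms] by (auto simp: effective_generators_def less_Suc_eq_le simp del: upt_Suc)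
qed

lemma distinct_effective_generators: "distinct (effective_generators S)"
  by (simp add: effective_generators_def)

lemma finite_descendants: "finite (descendants S g)"
  by (rule finite_subset[OF _ finite_semigroups_of_genus[of g]]) (auto simp: descendants_def)

lemma descendants_UNIV: "card (descendants UNIV g) = num_semigroups g"
  by (simp add: descendants_def num_semigroups_def conductor_UNIV)

lemma card_descendants_le_genus:
  assumes "numerical_semigroup S" "g \<le> genus S"
  shows "card (descendants S g) = (if g = genus S then 1 else 0)"
proof -
  have "T = S" if "T \<in> descendants S g" for T
  proof -
    have T: "numerical_semigroup T" "genus T = g" "T \<subseteq> S"
      using that by (auto simp: descendants_def)
    then have "- S = - T"
      using assms(2) by (intro card_seteq) (auto simp: genus_def numerical_semigroupD)
    then show ?thesis
      by auto
  qed
  moreover have "S \<in> descendants S (genus S)"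
    using assms(1) by (simp add: descendants_def)
  ultimately have "descendants S g = (if g = genus S then {S} else {})"
    by (auto simp: descendants_def)
  then show ?thesis
    by simp
qed

text \<open>
  A descendant \<open>T\<close> other than \<open>S\<close> descends from exactly one son, namely from \<open>S\<close> without the least
  element \<open>x\<close> of \<open>S - T\<close>. This \<open>x\<close> is irreducible, because the summands of a decomposition of \<open>x\<close>
  would be smaller elements of \<open>S\<close>, hence elements of \<open>T\<close>.
\<close>

lemma card_descendants_sons:
  assumes S: "numerical_semigroup S" and g: "genus S < g"
  shows "card (descendants S g) = (\<Sum>x\<leftarrow>effective_generators S. card (descendants (S - {x}) g))"
proof -
  let ?X = "set (effective_generators S)"
  have X: "irreducible_in S x \<and> conductor S \<le> x" if "x \<in> ?X" for x
    using that by (simp add: set_effective_generators[OF S])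
  have son: "T \<in> descendants (S - {x}) g \<longleftrightarrow>
      numerical_semigroup T \<and> genus T = g \<and> T \<subseteq> S \<and> x \<notin> T \<and> (\<forall>y\<in>S. y < x \<longrightarrow> y \<in> T)"
    if "x \<in> ?X" for T x
    using X[OF that] by (auto simp: descendants_def conductor_remove[OF S] less_Suc_eq)
  have "descendants S g = (\<Union>x\<in>?X. descendants (S - {x}) g)"
  proof (intro equalityI subsetI)
    fix T assume T: "T \<in> descendants S g"
    then have T': "numerical_semigroup T" "genus T = g" "T \<subseteq> S"
      by (auto simp: descendants_def)
    then have "S - T \<noteq> {}"
      using g by auto
    define x where "x = (LEAST x. x \<in> S - T)"
    have x: "x \<in> S - T"
      using \<open>S - T \<noteq> {}\<close> unfolding x_def by (metis LeastI ex_in_conv)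
    have below: "y \<in> T" if "y \<in> S" "y < x" for y
      using not_less_Least[of y "\<lambda>x. x \<in> S - T"] that unfolding x_def by simp
    have "conductor S \<le> x"
      using T x by (force simp: descendants_def)
    moreover have "irreducible_in S x"
      unfolding irreducible_in_def
    proof (intro conjI ballI notI)
      show "x \<in> S"
        using x by simp
      show False if "x = 0"
        using that x numerical_semigroupD(1)[OF T'(1)] by simp
      show False if "a \<in> S - {0}" "b \<in> S - {0}" "x = a + b" for a b
        using that x below[of a] below[of b] numerical_semigroupD(2)[OF T'(1), of a b] by simp
    qed
    ultimately have "x \<in> ?X"
      by (simp add: set_effective_generators[OF S])
    then show "T \<in> (\<Union>x\<in>?X. descendants (S - {x}) g)"
      using T' x below by (intro UN_I[of x]) (simp_all add: son)
  next
    fix T assume "T \<in> (\<Union>x\<in>?X. descendants (S - {x}) g)"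
    then obtain x where x: "x \<in> ?X" "T \<in> descendants (S - {x}) g"
      by blast
    then show "T \<in> descendants S g"
      using X[OF x(1)] son[OF x(1), of T] by (auto simp: descendants_def[of S])
  qed
  also have "card \<dots> = (\<Sum>x\<in>?X. card (descendants (S - {x}) g))"
  proof (rule card_UN_disjoint)
    show "\<forall>x\<in>?X. \<forall>x'\<in>?X. x \<noteq> x' \<longrightarrow> descendants (S - {x}) g \<inter> descendants (S - {x'}) g = {}"
    proof (intro ballI impI)
      fix x x' assume xx: "x \<in> ?X" "x' \<in> ?X" "x \<noteq> x'"
      then have "x \<in> S" "x' \<in> S"
        using X by (auto simp: irreducible_in_def)
      with xx show "descendants (S - {x}) g \<inter> descendants (S - {x'}) g = {}"
        by (cases x x' rule: linorder_cases) (auto simp: son)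
    qed
  qed (auto simp: finite_descendants)
  finally show ?thesis
    by (simp add: sum_list_distinct_conv_sum_set distinct_effective_generators)
qed


section \<open>Executions within the bounds on integers, lengths and height\<close>

definition rep_of :: "nat \<Rightarrow> nat set \<Rightarrow> rep" where
  "rep_of G S =
     Rep (conductor S) (genus S) (multiplicity S) (map (decomposition_number S) [0..<3 * G + 1])"

lemma cost_le:
  assumes "\<And>x. x \<in> set xs \<Longrightarrow> w x \<le> u"
  shows "cost w xs \<le> length xs * u"
  using assms unfolding cost_def by (induction xs) (auto intro: add_mono)

text \<open>
  All integers other than the counters, the height of the stack included, are at most
  \<open>(G + 1) * (G + 2)\<close>, and the counters are at most \<open>K\<close>. The asymptotic assumptions on \<open>tc\<close> and \<open>sc\<close>
  enter only through the bounds \<open>w\<close> and \<open>wK\<close> for these two ranges.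
\<close>

locale cost_bounds =
  fixes tc sc :: "nat \<Rightarrow> nat" and G K w wK :: nat
  assumes tc_le: "n \<le> (G + 1) * (G + 2) \<Longrightarrow> tc n \<le> w"
    and sc_le: "n \<le> (G + 1) * (G + 2) \<Longrightarrow> sc n \<le> w"
    and tc_le_K: "n \<le> K \<Longrightarrow> tc n \<le> wK"
    and sc_le_K: "n \<le> K \<Longrightarrow> sc n \<le> wK"
begin

definition B :: nat where
  "B = (G + 1) * (G + 2)"

definition fits_rep :: "rep \<Rightarrow> bool" where
  "fits_rep R \<longleftrightarrow> length (rd R) \<le> 3 * G + 1 \<and> (\<forall>n\<in>set (rep_ints R). n \<le> B)"

definition fits :: "state \<Rightarrow> bool" where
  "fits s \<longleftrightarrow>
     (\<forall>v. vars s v \<le> B) \<and>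
     (\<forall>r. length (arrs s (Fd r)) \<le> 3 * G + 1 \<and> (\<forall>n\<in>set (arrs s (Fd r)). n \<le> B)) \<and>
     length (arrs s Cnt) \<le> G + 1 \<and> (\<forall>n\<in>set (arrs s Cnt). n \<le> K) \<and>
     length (stack s) \<le> B \<and> (\<forall>R\<in>set (stack s). fits_rep R)"

text \<open>
  Nine integers suffice for the evaluation of any expression of the program; the value that is then
  assigned accounts for a tenth step. This is the origin of the constant 10 below.
\<close>

definition small :: "nat list \<Rightarrow> bool" where
  "small xs \<longleftrightarrow> length xs \<le> 9 \<and> (\<forall>x\<in>set xs. x \<le> B)"

text \<open>
  In this order: the nine variables, the counters, the two arrays of decomposition numbers, the height
  of the stack, its contents, and the temporaries of a single step.
\<close>

definition max_mem :: nat where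
  "max_mem = 9 * w + (G + 1) * wK + 2 * ((3 * G + 1) * w) + w + B * ((3 * G + 4) * w)
     + 10 * (w + wK)"

text \<open>
  A weakest precondition for terminating executions in which time and memory are bounded. The time bound
  \<open>T\<close> composes along the program, whereas the memory bound is uniform: it follows for every step from
  \<open>fits\<close>, which is why the rules below carry \<open>fits\<close> along.
\<close>

definition runs :: "com \<Rightarrow> state \<Rightarrow> nat \<Rightarrow> (state \<Rightarrow> bool) \<Rightarrow> bool" where
  "runs c s T Q \<longleftrightarrow> (\<exists>t m s'. exec tc sc c s t m s' \<and> t \<le> T \<and> m \<le> max_mem \<and> Q s')"

lemma runsI: "exec tc sc c s t m s' \<Longrightarrow> t \<le> T \<Longrightarrow> m \<le> max_mem \<Longrightarrow> Q s' \<Longrightarrow> runs c s T Q"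
  unfolding runs_def by blast

lemma B_ge: "3 * G + 2 \<le> B"
  by (simp add: B_def)

lemma fitsD:
  assumes "fits s"
  shows "vars s v \<le> B" "length (arrs s (Fd r)) \<le> 3 * G + 1"
    "n \<in> set (arrs s (Fd r)) \<Longrightarrow> n \<le> B"
    "length (arrs s Cnt) \<le> G + 1" "n \<in> set (arrs s Cnt) \<Longrightarrow> n \<le> K"
    "length (stack s) \<le> B" "R \<in> set (stack s) \<Longrightarrow> fits_rep R"
  using assms by (auto simp: fits_def)

lemma fits_nth: "fits s \<Longrightarrow> i < length (arrs s (Fd r)) \<Longrightarrow> arrs s (Fd r) ! i \<le> B"
  using fitsD(3)[where r = r] by simp

lemma mem_le:
  assumes "fits s"
  shows "mem sc s + 10 * (w + wK) \<le> max_mem"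
proof -
  have V: "(UNIV :: vname set)
      = {VG, VX, VY, Fc RegS, Fc RegT, Fg RegS, Fg RegT, Fm RegS, Fm RegT}"
  proof (rule UNIV_eq_I)
    show "v \<in> {VG, VX, VY, Fc RegS, Fc RegT, Fg RegS, Fg RegT, Fm RegS, Fm RegT}" for v
      by (cases v; simp; metis reg.exhaust)
  qed
  have "(\<Sum>v\<in>UNIV. sc (vars s v)) \<le> (\<Sum>v\<in>(UNIV :: vname set). w)"
    using fitsD(1)[OF assms] by (intro sum_mono sc_le) (simp add: B_def)
  also have "\<dots> = 9 * w"
    unfolding V by simp
  finally have vars: "(\<Sum>v\<in>UNIV. sc (vars s v)) \<le> 9 * w" .
  have A: "(UNIV :: aname set) = {Cnt, Fd RegS, Fd RegT}"
  proof (rule UNIV_eq_I)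
    show "a \<in> {Cnt, Fd RegS, Fd RegT}" for a
      by (cases a; simp; metis reg.exhaust)
  qed
  have "cost sc (arrs s Cnt) \<le> length (arrs s Cnt) * wK"
    by (intro cost_le sc_le_K fitsD(5)[OF assms])
  also have "\<dots> \<le> (G + 1) * wK"
    by (intro mult_right_mono fitsD(4)[OF assms]) simp
  finally have Cnt: "cost sc (arrs s Cnt) \<le> (G + 1) * wK" .
  have Fd: "cost sc (arrs s (Fd r)) \<le> (3 * G + 1) * w" for r
  proof -
    have "cost sc (arrs s (Fd r)) \<le> length (arrs s (Fd r)) * w"
      using fitsD(3)[OF assms] by (intro cost_le sc_le) (simp add: B_def)
    also have "\<dots> \<le> (3 * G + 1) * w"
      by (intro mult_right_mono fitsD(2)[OF assms]) simp
    finally show ?thesis .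
  qed
  have height: "sc (length (stack s)) \<le> w"
    using fitsD(6)[OF assms] by (intro sc_le) (simp add: B_def)
  have rep: "cost sc (rep_ints R) \<le> (3 * G + 4) * w" if "R \<in> set (stack s)" for R
  proof -
    have R: "fits_rep R"
      using fitsD(7)[OF assms that] .
    then have "cost sc (rep_ints R) \<le> length (rep_ints R) * w"
      by (intro cost_le sc_le) (auto simp: fits_rep_def B_def)
    also have "\<dots> \<le> (3 * G + 4) * w"
      using R by (intro mult_right_mono) (simp_all add: fits_rep_def rep_ints_def)
    finally show ?thesis .
  qed
  have "(\<Sum>R\<leftarrow>stack s. cost sc (rep_ints R)) \<le> (\<Sum>R\<leftarrow>stack s. (3 * G + 4) * w)"
    using rep by (intro sum_list_mono)
  also have "\<dots> = length (stack s) * ((3 * G + 4) * w)"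
    by (simp only: sum_list_triv of_nat_id)
  also have "\<dots> \<le> B * ((3 * G + 4) * w)"
    by (intro mult_right_mono fitsD(6)[OF assms]) simp
  finally have stack: "(\<Sum>R\<leftarrow>stack s. cost sc (rep_ints R)) \<le> B * ((3 * G + 4) * w)" .
  show ?thesis
    unfolding mem_def A max_mem_def
    using vars Cnt Fd[of RegS] Fd[of RegT] height stack by simp
qed

lemma cost_small:
  assumes "small xs"
  shows "cost tc xs \<le> 9 * w" "cost sc xs \<le> 9 * w"
proof -
  have len: "length xs * w \<le> 9 * w"
    using assms by (intro mult_right_mono) (simp_all add: small_def)
  have "cost tc xs \<le> length xs * w" "cost sc xs \<le> length xs * w"
    using assms by (auto intro!: cost_le tc_le sc_le simp: small_def B_def)
  with len show "cost tc xs \<le> 9 * w" "cost sc xs \<le> 9 * w"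
    by (blast intro: order_trans)+
qed

lemma peak_le:
  assumes "fits s" "fits s'" "cost sc tmp \<le> 10 * (w + wK)"
  shows "peak sc s tmp s' \<le> max_mem"
  using mem_le[OF assms(1)] mem_le[OF assms(2)] assms(3) by (simp add: peak_def)

lemma peak_small_le: "fits s \<Longrightarrow> fits s' \<Longrightarrow> small tmp \<Longrightarrow> peak sc s tmp s' \<le> max_mem"
  by (intro peak_le order_trans[OF cost_small(2)]) simp_all

lemma runs_mono:
  "runs c s T Q \<Longrightarrow> T \<le> T' \<Longrightarrow> (\<And>s'. Q s' \<Longrightarrow> Q' s') \<Longrightarrow> runs c s T' Q'"
  unfolding runs_def by (meson order_trans)

lemma runs_SKIP: "fits s \<Longrightarrow> Q s \<Longrightarrow> runs SKIP s T Q"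
  unfolding runs_def using mem_le by (force intro: exec.Skip)

lemma runs_Seq:
  assumes "runs c1 s T1 (\<lambda>s'. runs c2 s' T2 Q)"
  shows "runs (c1;; c2) s (T1 + T2) Q"
proof -
  obtain t1 m1 s1 where 1: "exec tc sc c1 s t1 m1 s1" "t1 \<le> T1" "m1 \<le> max_mem"
    and "runs c2 s1 T2 Q"
    using assms unfolding runs_def by blast
  then obtain t2 m2 s2 where 2: "exec tc sc c2 s1 t2 m2 s2" "t2 \<le> T2" "m2 \<le> max_mem" "Q s2"
    unfolding runs_def by blast
  show ?thesis
    using 1 2 by (intro runsI[OF exec.Seq[OF 1(1) 2(1)]]) simp_all
qed

lemma runs_If:
  assumes "fits s" "bsafe b s" "small (bvals b s)"
    and "bval b s \<Longrightarrow> runs c1 s T Q" "\<not> bval b s \<Longrightarrow> runs c2 s T Q"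
  shows "runs (IF b THEN c1 ELSE c2) s (10 * w + T) Q"
proof (cases "bval b s")
  case True
  with assms obtain t m s' where e: "exec tc sc c1 s t m s'" "t \<le> T" "m \<le> max_mem" "Q s'"
    unfolding runs_def by blast
  show ?thesis
    using e(2-4) cost_small(1)[OF assms(3)] peak_small_le[OF assms(1,1,3)]
    by (intro runsI[OF exec.IfTrue[OF assms(2) True e(1)]]) auto
next
  case False
  with assms obtain t m s' where e: "exec tc sc c2 s t m s'" "t \<le> T" "m \<le> max_mem" "Q s'"
    unfolding runs_def by blast
  show ?thesis
    using e(2-4) cost_small(1)[OF assms(3)] peak_small_le[OF assms(1,1,3)]
    by (intro runsI[OF exec.IfFalse[OF assms(2) False e(1)]]) auto
qed

lemma runs_While_False:
  assumes "fits s" "bsafe b s" "small (bvals b s)" "\<not> bval b s" "Q s"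
  shows "runs (WHILE b DO c) s (10 * w) Q"
  using assms(5) cost_small(1)[OF assms(3)] peak_small_le[OF assms(1,1,3)]
  by (intro runsI[OF exec.WhileFalse[OF assms(2,4)]]) auto

lemma runs_While_True:
  assumes "fits s" "bsafe b s" "small (bvals b s)" "bval b s"
    and "runs c s T1 (\<lambda>s'. runs (WHILE b DO c) s' T2 Q)"
  shows "runs (WHILE b DO c) s (10 * w + T1 + T2) Q"
proof -
  obtain t1 m1 s1 where 1: "exec tc sc c s t1 m1 s1" "t1 \<le> T1" "m1 \<le> max_mem"
    and "runs (WHILE b DO c) s1 T2 Q"
    using assms(5) unfolding runs_def by blast
  then obtain t2 m2 s2
    where 2: "exec tc sc (WHILE b DO c) s1 t2 m2 s2" "t2 \<le> T2" "m2 \<le> max_mem" "Q s2"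
    unfolding runs_def by blast
  show ?thesis
    using 1 2 cost_small(1)[OF assms(3)] peak_small_le[OF assms(1,1,3)]
    by (intro runsI[OF exec.WhileTrue[OF assms(2,4) 1(1) 2(1)]]) auto
qed

lemma fits_assign: "fits s \<Longrightarrow> n \<le> B \<Longrightarrow> fits (s\<lparr>vars := (vars s)(v := n)\<rparr>)"
  by (auto simp: fits_def)

lemma runs_Assign:
  assumes "fits s" "asafe e s" "small (avals e s)" "aval e s \<le> B"
    and "\<And>s'. s' = s\<lparr>vars := (vars s)(v := aval e s)\<rparr> \<Longrightarrow> fits s' \<Longrightarrow> Q s'"
  shows "runs (v ::= e) s (10 * w) Q"
proof -
  let ?s = "s\<lparr>vars := (vars s)(v := aval e s)\<rparr>"
  have fits: "fits ?s"
    using assms(1,4) by (rule fits_assign)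
  have "tc (aval e s) \<le> w"
    using assms(4) by (intro tc_le) (simp add: B_def)
  then have "cost tc (avals e s @ [aval e s]) \<le> 10 * w"
    using cost_small(1)[OF assms(3)] by (simp add: cost_def)
  then show ?thesis
    by (intro runsI[OF exec.Assign[OF assms(2) refl]]
          peak_small_le[OF assms(1) fits assms(3)] assms(5)[OF refl fits])
qed

lemma runs_Store:
  assumes "fits s" "asafe i s" "asafe e s" "small (avals i s @ avals e s)" "aval e s \<le> B"
    "aval i s < length (arrs s (Fd r))"
    and "\<And>s'. s' = s\<lparr>arrs := (arrs s)(Fd r := (arrs s (Fd r))[aval i s := aval e s])\<rparr> \<Longrightarrow>
      fits s' \<Longrightarrow> Q s'"
  shows "runs (Store (Fd r) i e) s (10 * w) Q"
proof -
  let ?s = "s\<lparr>arrs := (arrs s)(Fd r := (arrs s (Fd r))[aval i s := aval e s])\<rparr>"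
  have fits: "fits ?s"
    using assms(1,5) set_update_subset_insert[of "arrs s (Fd r)"]
    by (fastforce simp: fits_def)
  have "tc (aval e s) \<le> w"
    using assms(5) by (intro tc_le) (simp add: B_def)
  then have "cost tc (avals i s @ avals e s @ [aval e s]) \<le> 10 * w"
    using cost_small(1)[OF assms(4)] by (simp add: cost_def)
  then show ?thesis
    by (intro runsI[OF exec.Store[OF assms(2,3,6) refl]]
          peak_small_le[OF assms(1) fits assms(4)] assms(7)[OF refl fits])
qed

text \<open>
  The only step that handles a counter, hence the only one that is paid for with \<open>wK\<close>.
\<close>

lemma runs_increment_Cnt:
  assumes "fits s" "vars s v < length (arrs s Cnt)" "arrs s Cnt ! vars s v < K"
    and "\<And>s'. s' = s\<lparr>arrs := (arrs s)(Cnt := (arrs s Cnt)[vars s v := Suc (arrs s Cnt ! vars s v)])\<rparr>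
      \<Longrightarrow> fits s' \<Longrightarrow> Q s'"
  shows "runs (Store Cnt (Var v) (Plus (Get Cnt (Var v)) (Num 1))) s (10 * (w + wK)) Q"
proof -
  let ?i = "Var v" and ?e = "Plus (Get Cnt (Var v)) (Num 1)"
  let ?s = "s\<lparr>arrs := (arrs s)(Cnt := (arrs s Cnt)[vars s v := Suc (arrs s Cnt ! vars s v)])\<rparr>"
  have "set ((arrs s Cnt)[vars s v := Suc (arrs s Cnt ! vars s v)])
      \<subseteq> insert (Suc (arrs s Cnt ! vars s v)) (set (arrs s Cnt))"
    by (rule set_update_subset_insert)
  then have fits: "fits ?s"
    using assms(1,3) by (auto simp: fits_def)
  have "cost f (avals ?i s @ avals ?e s @ [aval ?e s]) \<le> 6 * (w + wK)"
    if "\<And>n. n \<le> B \<Longrightarrow> f n \<le> w" "\<And>n. n \<le> K \<Longrightarrow> f n \<le> wK" for f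
  proof -
    have "f n \<le> w + wK" if "n \<le> B \<or> n \<le> K" for n
      using that \<open>\<And>n. n \<le> B \<Longrightarrow> f n \<le> w\<close>[of n] \<open>\<And>n. n \<le> K \<Longrightarrow> f n \<le> wK\<close>[of n] by auto
    moreover have "vars s v \<le> B" "1 \<le> B"
      using fitsD(1)[OF assms(1)] B_ge by simp_all
    ultimately have "cost f (avals ?i s @ avals ?e s @ [aval ?e s])
        \<le> length (avals ?i s @ avals ?e s @ [aval ?e s]) * (w + wK)"
      using assms(3) by (intro cost_le) auto
    then show ?thesis
      by simp
  qed
  from this[of tc] this[of sc]
  have "cost tc (avals ?i s @ avals ?e s @ [aval ?e s]) \<le> 6 * (w + wK)"
    "cost sc (avals ?i s @ avals ?e s @ [aval ?e s]) \<le> 6 * (w + wK)"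
    using tc_le tc_le_K sc_le sc_le_K by (simp_all add: B_def)
  then have cost: "cost tc (avals ?i s @ avals ?e s @ [aval ?e s]) \<le> 10 * (w + wK)"
    "cost sc (avals ?i s @ avals ?e s) \<le> 10 * (w + wK)"
    by (simp_all add: cost_def)
  have "asafe ?i s" "asafe ?e s" "aval ?i s < length (arrs s Cnt)"
    "?s = s\<lparr>arrs := (arrs s)(Cnt := (arrs s Cnt)[aval ?i s := aval ?e s])\<rparr>"
    using assms(2) by simp_all
  from exec.Store[OF this] show ?thesis
    using cost(1) peak_le[OF assms(1) fits cost(2)] assms(4)[OF refl fits] by (rule runsI)
qed

text \<open>
  Initializing or transferring an array pays for each cell through its index and its contents, which
  gives the same bound for creating, copying, pushing and popping an array.
\<close>

lemma cost_indexed: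
  assumes "length xs \<le> 3 * G + 4" "n \<le> 3 * G + 1" "\<And>x. x \<in> set xs \<Longrightarrow> x \<le> B"
  shows "cost tc ([0..<n] @ xs) \<le> (6 * G + 5) * w"
proof -
  have "cost tc ([0..<n] @ xs) \<le> length ([0..<n] @ xs) * w"
    using assms B_ge by (intro cost_le tc_le, fold B_def) fastforce
  also have "\<dots> \<le> (6 * G + 5) * w"
    using assms by (intro mult_right_mono) auto
  finally show ?thesis .
qed

lemma runs_New:
  assumes "fits s" "asafe e s" "small (avals e s)" "aval e s \<le> 3 * G + 1"
    and "a = Cnt \<Longrightarrow> aval e s \<le> G + 1"
    and "\<And>s'. s' = s\<lparr>arrs := (arrs s)(a := replicate (aval e s) 0)\<rparr> \<Longrightarrow> fits s' \<Longrightarrow> Q s'"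
  shows "runs (New a e) s ((6 * G + 14) * w) Q"
proof -
  let ?s = "s\<lparr>arrs := (arrs s)(a := replicate (aval e s) 0)\<rparr>"
  have fits: "fits ?s"
    using assms(1,4,5) by (cases a) (auto simp: fits_def)
  have "cost tc ([0..<aval e s] @ replicate (aval e s) 0) \<le> (6 * G + 5) * w"
    using assms(4) by (intro cost_indexed) auto
  then have "cost tc (avals e s @ [0..<aval e s] @ replicate (aval e s) 0) \<le> (6 * G + 14) * w"
    using cost_small(1)[OF assms(3)] by (simp add: cost_def algebra_simps)
  then show ?thesis
    by (intro runsI[OF exec.New[OF assms(2) refl]]
          peak_small_le[OF assms(1) fits assms(3)] assms(6)[OF refl fits])
qed

lemma small_Nil: "small []"
  by (simp add: small_def)

lemma runs_Copy:
  assumes "fits s"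
    and "\<And>s'. s' = s\<lparr>arrs := (arrs s)(Fd r := arrs s (Fd q))\<rparr> \<Longrightarrow> fits s' \<Longrightarrow> Q s'"
  shows "runs (Copy (Fd r) (Fd q)) s ((6 * G + 14) * w) Q"
proof -
  let ?s = "s\<lparr>arrs := (arrs s)(Fd r := arrs s (Fd q))\<rparr>"
  have fits: "fits ?s"
    using assms(1) by (auto simp: fits_def)
  have "cost tc ([0..<length (arrs s (Fd q))] @ arrs s (Fd q)) \<le> (6 * G + 5) * w"
    using fitsD(2)[OF assms(1), of q] fitsD(3)[OF assms(1), where r = q] by (intro cost_indexed) auto
  then have "cost tc ([0..<length (arrs s (Fd q))] @ arrs s (Fd q)) \<le> (6 * G + 14) * w"
    by (simp add: algebra_simps)
  then show ?thesis
    by (intro runsI[OF exec.Copy[OF refl]]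
          peak_small_le[OF assms(1) fits small_Nil] assms(2)[OF refl fits])
qed

lemma runs_ClearStack:
  assumes "fits s" "\<And>s'. s' = s\<lparr>stack := []\<rparr> \<Longrightarrow> fits s' \<Longrightarrow> Q s'"
  shows "runs ClearStack s (10 * w) Q"
proof -
  have fits: "fits (s\<lparr>stack := []\<rparr>)"
    using assms(1) by (auto simp: fits_def)
  have "cost tc [0] \<le> 10 * w"
    using tc_le[of 0] by (simp add: cost_def)
  then show ?thesis
    by (intro runsI[OF exec.ClearStack[OF refl]]
          peak_small_le[OF assms(1) fits small_Nil] assms(2)[OF refl fits])
qed

lemma cost_transfer:
  assumes "fits_rep R" "h \<le> B"
  shows "cost tc (h # [0..<length (rd R)] @ rep_ints R) \<le> (6 * G + 14) * w"
proof -
  have "cost tc ([0..<length (rd R)] @ rep_ints R) \<le> (6 * G + 5) * w"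
    using assms(1) by (intro cost_indexed) (auto simp: fits_rep_def rep_ints_def)
  moreover have "tc h \<le> w"
    using assms(2) by (intro tc_le) (simp add: B_def)
  ultimately show ?thesis
    by (simp add: cost_def algebra_simps)
qed

lemma fits_get_rep: "fits s \<Longrightarrow> fits_rep (get_rep r s)"
  by (auto simp: fits_def fits_rep_def get_rep_def rep_ints_def)

lemma runs_Push:
  assumes "fits s" "length (stack s) < B"
    and "\<And>s'. s' = s\<lparr>stack := get_rep r s # stack s\<rparr> \<Longrightarrow> fits s' \<Longrightarrow> Q s'"
  shows "runs (Push r) s ((6 * G + 14) * w) Q"
proof -
  have fits: "fits (s\<lparr>stack := get_rep r s # stack s\<rparr>)"
    using assms(1,2) fits_get_rep[OF assms(1)] by (auto simp: fits_def)
  show ?thesis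
    by (intro runsI[OF exec.Push[OF refl refl]]
          cost_transfer[OF fits_get_rep[OF assms(1)] fitsD(6)[OF assms(1)]] peak_small_le[OF assms(1) fits small_Nil] assms(3)[OF refl fits])
qed

lemma runs_Pop:
  assumes "fits s" "stack s = R # Rs"
    and "\<And>s'. s' = (set_rep r R s)\<lparr>stack := Rs\<rparr> \<Longrightarrow> fits s' \<Longrightarrow> Q s'"
  shows "runs (Pop r) s ((6 * G + 14) * w) Q"
proof -
  have R: "fits_rep R"
    using fitsD(7)[OF assms(1)] assms(2) by simp
  then have fits: "fits ((set_rep r R s)\<lparr>stack := Rs\<rparr>)"
    using assms(1,2) by (auto simp: fits_def fits_rep_def set_rep_def rep_ints_def)
  show ?thesis
    by (intro runsI[OF exec.Pop[OF assms(2) refl]]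
          cost_transfer[OF R fitsD(6)[OF assms(1)]] peak_small_le[OF assms(1) fits small_Nil] assms(3)[OF refl fits])
qed

text \<open>
  The loop variable exceeds \<open>b\<close> at the end, so \<open>b\<close> has to be strictly below the bound on integers.
  The time bound \<open>T\<close> may depend on the iteration; in the loop over the candidates only those
  iterations are expensive that push a son.
\<close>

lemma runs_For:
  assumes init: "fits s" "asafe e1 s" "small (avals e1 s)" "aval e1 s = a" "a \<le> Suc b" "b < B"
    and P: "P a (s\<lparr>vars := (vars s)(v := a)\<rparr>)"
    and guard: "\<And>i s. fits s \<Longrightarrow> P i s \<Longrightarrow>
      vars s v = i \<and> asafe e2 s \<and> aval e2 s = b \<and> small (bvals (Leq (Var v) e2) s)"
    and body: "\<And>i s. a \<le> i \<Longrightarrow> i \<le> b \<Longrightarrow> fits s \<Longrightarrow> P i s \<Longrightarrow>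
      runs c s (T i) (\<lambda>s'. fits s' \<and> vars s' v = i \<and> P (Suc i) (s'\<lparr>vars := (vars s')(v := Suc i)\<rparr>))"
    and Q: "\<And>s. fits s \<Longrightarrow> P (Suc b) s \<Longrightarrow> Q s"
  shows "runs (FOR v FROM e1 TO e2 DO c) s ((\<Sum>i=a..b. T i + 20 * w) + 20 * w) Q"
proof -
  let ?loop = "WHILE Leq (Var v) e2 DO (c;; v ::= Plus (Var v) (Num 1))"
  have loop: "runs ?loop s ((\<Sum>i\<in>{k..b}. T i + 20 * w) + 10 * w) Q"
    if "a \<le> k" "k \<le> Suc b" "fits s" "P k s" for k s
    using that(2,1,3,4)
  proof (induction k arbitrary: s rule: inc_induct)
    case base
    note guard[OF this(2,3)]
    with base Q[OF base(2,3)] show ?case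
      by (simp, intro runs_While_False) simp_all
  next
    case (step k)
    have g: "vars s v = k" "asafe e2 s" "aval e2 s = b" "small (bvals (Leq (Var v) e2) s)"
      using guard[OF step.prems(2,3)] by auto
    have "runs ?loop s (10 * w + (T k + 10 * w) + ((\<Sum>i\<in>{Suc k..b}. T i + 20 * w) + 10 * w)) Q"
    proof (rule runs_While_True)
      show "runs (c;; v ::= Plus (Var v) (Num 1)) s (T k + 10 * w)
          (\<lambda>s'. runs ?loop s' ((\<Sum>i\<in>{Suc k..b}. T i + 20 * w) + 10 * w) Q)"
      proof (rule runs_Seq, rule runs_mono[OF body order_refl])
        fix s' assume s': "fits s' \<and> vars s' v = k \<and> P (Suc k) (s'\<lparr>vars := (vars s')(v := Suc k)\<rparr>)"
        show "runs (v ::= Plus (Var v) (Num 1)) s' (10 * w)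
            (\<lambda>s'. runs ?loop s' ((\<Sum>i\<in>{Suc k..b}. T i + 20 * w) + 10 * w) Q)"
          by (rule runs_Assign)
            (use s' step.hyps step.prems(1) step.IH init(6) in \<open>auto simp: small_def\<close>)
      qed (use step in auto)
    qed (use g step in auto)
    moreover have "(\<Sum>i\<in>{k..b}. T i + 20 * w) = T k + 20 * w + (\<Sum>i\<in>{Suc k..b}. T i + 20 * w)"
      using step.hyps by (simp add: sum.atLeast_Suc_atMost)
    ultimately show ?case
      by (simp add: algebra_simps)
  qed
  have "runs (FOR v FROM e1 TO e2 DO c) s
      (10 * w + ((\<Sum>i\<in>{a..b}. T i + 20 * w) + 10 * w)) Q"
    using init P by (intro runs_Seq runs_Assign loop) auto
  then show ?thesis
    by (simp add: algebra_simps)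
qed

end


section \<open>The pending semigroups\<close>

text \<open>
  The list in stack order: the son that is pushed last, which has the largest removed element, is on
  top. At genus \<open>G\<close> the exploration stops.
\<close>

definition sons :: "nat \<Rightarrow> nat set \<Rightarrow> nat set list" where
  "sons G S = (if genus S < G then rev (map (\<lambda>x. S - {x}) (effective_generators S)) else [])"

definition count_descendants :: "nat set list \<Rightarrow> nat \<Rightarrow> nat" where
  "count_descendants Ss g = (\<Sum>S\<leftarrow>Ss. card (descendants S g))"

text \<open>
  The invariant of the list of semigroups whose representations are on the stack. The last two
  conditions bound its length.
\<close>

definition pending :: "nat \<Rightarrow> nat set list \<Rightarrow> bool" where
  "pending G Ss \<longleftrightarrow>
     (\<forall>S\<in>set Ss. numerical_semigroup S \<and> genus S \<le> G) \<and>
     sorted_wrt (\<lambda>S T. genus T \<le> genus S) Ss \<and>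
     (\<forall>g. length (filter (\<lambda>S. genus S = g) Ss) \<le> G + 1)"

definition VISIT :: com where
  "VISIT =
     Pop RegS;;
     Cnt\<langle>Var (Fg RegS)\<rangle> ::= Plus (Get Cnt (Var (Fg RegS))) (Num 1);;
     (IF Neg (Leq (Var VG) (Var (Fg RegS)))
      THEN
        FOR VX FROM Var (Fc RegS) TO Plus (Var (Fc RegS)) (Var (Fm RegS)) DO
          (IF Conj (Neg (Equal (Var VX) (Num 0))) (Equal (Get (Fd RegS) (Var VX)) (Num 1))
           THEN SON RegS VX RegT;; Push RegT
           ELSE SKIP)
      ELSE SKIP)"

lemma count_descendants_Nil: "count_descendants [] g = 0"
  by (simp add: count_descendants_def)

lemma count_descendants_Cons:
  "count_descendants (S # Ss) g = card (descendants S g) + count_descendants Ss g"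
  by (simp add: count_descendants_def)

lemma count_descendants_append:
  "count_descendants (Ss @ Ts) g = count_descendants Ss g + count_descendants Ts g"
  by (simp add: count_descendants_def)

lemma sons_properties:
  assumes "numerical_semigroup S" "T \<in> set (sons G S)"
  shows "numerical_semigroup T" "genus T = genus S + 1" "genus S < G"
  using assms set_effective_generators[OF assms(1)]
  by (auto simp: sons_def numerical_semigroup_remove genus_remove split: if_splits)

text \<open>
  There are \<open>m + 1\<close> candidates, and \<open>m + 1 \<le> genus S + 2 \<le> G + 1\<close> if the genus is below \<open>G\<close>.
\<close>

lemma length_sons_le:
  assumes "numerical_semigroup S"
  shows "length (sons G S) \<le> G + 1"
proof (cases "genus S < G")
  case True
  have "length (effective_generators S) \<le> multiplicity S + 1"
    unfolding effective_generators_def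
    using length_filter_le[of _ "[conductor S..<Suc (conductor S + multiplicity S)]"]
    by (rule order_trans) simp
  with True multiplicity_le_genus[OF assms] show ?thesis
    by (simp add: sons_def)
qed (simp add: sons_def)

lemma card_descendants_rec:
  assumes S: "numerical_semigroup S" "genus S \<le> G" and g: "g \<le> G"
  shows "card (descendants S g) = (if g = genus S then 1 else 0) + count_descendants (sons G S) g"
proof (cases "g \<le> genus S")
  case True
  have "card (descendants T g) = 0" if "T \<in> set (sons G S)" for T
    using sons_properties[OF S(1) that] True card_descendants_le_genus[of T g] by simp
  then have "count_descendants (sons G S) g = 0"
    by (simp add: count_descendants_def)
  with True show ?thesis
    by (simp add: card_descendants_le_genus[OF S(1)])
next
  case False
  with g have "count_descendants (sons G S) g =
      (\<Sum>x\<leftarrow>effective_generators S. card (descendants (S - {x}) g))"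
    by (simp add: count_descendants_def sons_def rev_map[symmetric] comp_def sum_list_rev)
  with False show ?thesis
    using card_descendants_sons[OF S(1), of g] by simp
qed

lemma length_eq_sum_filter:
  fixes f :: "'a \<Rightarrow> nat"
  assumes "\<And>x. x \<in> set xs \<Longrightarrow> f x \<le> n"
  shows "length xs = (\<Sum>k\<le>n. length (filter (\<lambda>x. f x = k) xs))"
  using assms
proof (induction xs)
  case (Cons x xs)
  have "(\<Sum>k\<le>n. length (filter (\<lambda>x. f x = k) (x # xs)))
      = (\<Sum>k\<le>n. (if f x = k then 1 else 0) + length (filter (\<lambda>x. f x = k) xs))"
    by (intro sum.cong) auto
  also have "\<dots> = 1 + length xs"
    using Cons by (simp add: sum.distrib)
  finally show ?case
    by simp
qed simp

lemma pending_length_le: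
  assumes "pending G Ss"
  shows "length Ss \<le> (G + 1) * (G + 1)"
proof -
  have "length Ss = (\<Sum>g\<le>G. length (filter (\<lambda>S. genus S = g) Ss))"
    using assms by (intro length_eq_sum_filter) (auto simp: pending_def)
  also have "\<dots> \<le> (\<Sum>g\<le>G. G + 1)"
    using assms unfolding pending_def by (intro sum_mono) blast
  finally show ?thesis
    by simp
qed

text \<open>
  The popped semigroup has the largest genus on the stack. Its sons exceed this genus by one, so they
  are the only entries of their genus.
\<close>

lemma pending_step:
  assumes "pending G (S # Ss)"
  shows "pending G (sons G S @ Ss)"
proof -
  have S: "numerical_semigroup S"
    using assms by (simp add: pending_def)
  have below: "genus T \<le> genus S" if "T \<in> set Ss" for T
    using assms that by (simp add: pending_def)
  have sons: "numerical_semigroup T" "genus T = genus S + 1" "genus S < G"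
    if "T \<in> set (sons G S)" for T
    using sons_properties[OF S that] by simp_all
  have "length (filter (\<lambda>T. genus T = g) (sons G S @ Ss)) \<le> G + 1" for g
  proof (cases "g = genus S + 1")
    case True
    then have "filter (\<lambda>T. genus T = g) Ss = []"
      using below by (fastforce simp: filter_empty_conv)
    moreover have "length (filter (\<lambda>T. genus T = g) (sons G S)) \<le> G + 1"
      using length_filter_le length_sons_le[OF S] by (rule order_trans)
    ultimately show ?thesis
      by simp
  next
    case False
    then have "filter (\<lambda>T. genus T = g) (sons G S) = []"
      using sons by (auto simp: filter_empty_conv)
    moreover have "length (filter (\<lambda>T. genus T = g) (S # Ss)) \<le> G + 1"
      using assms unfolding pending_def by blast
    ultimately show ?thesis
      by (simp split: if_splits)
  qed
  moreover have "numerical_semigroup T \<and> genus T \<le> G" if "T \<in> set (sons G S @ Ss)" for T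
    using that sons[of T] assms by (auto simp: pending_def)
  moreover have "sorted_wrt (\<lambda>T U. genus U \<le> genus T) (sons G S @ Ss)"
    unfolding sorted_wrt_append
  proof (intro conjI ballI)
    show "sorted_wrt (\<lambda>T U. genus U \<le> genus T) (sons G S)"
      unfolding sorted_wrt_iff_nth_less by (simp add: sons(2))
    show "sorted_wrt (\<lambda>T U. genus U \<le> genus T) Ss"
      using assms by (simp add: pending_def)
    show "genus U \<le> genus T" if "T \<in> set (sons G S)" "U \<in> set Ss" for T U
      using sons(2)[OF that(1)] below[OF that(2)] by simp
  qed
  ultimately show ?thesis
    unfolding pending_def by blast
qed

lemma pending_UNIV: "pending G [UNIV]"
  by (simp add: pending_def numerical_semigroup_UNIV genus_UNIV)

lemma pending_length_le_count:
  assumes "pending G Ss"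
  shows "length Ss \<le> (\<Sum>g\<le>G. count_descendants Ss g)"
proof -
  have "\<forall>S\<in>set Ss. numerical_semigroup S \<and> genus S \<le> G"
    using assms by (simp add: pending_def)
  then show ?thesis
  proof (induction Ss)
    case (Cons S Ss)
    then have "1 = (\<Sum>g\<in>{genus S}. card (descendants S g))"
      by (simp add: card_descendants_le_genus)
    also have "\<dots> \<le> (\<Sum>g\<le>G. card (descendants S g))"
      using Cons.prems by (intro sum_mono2) auto
    finally show ?case
      using Cons by (simp add: count_descendants_Cons sum.distrib)
  qed simp
qed

lemma count_descendants_step:
  assumes "pending G (S # Ss)" "g \<le> G"
  shows "count_descendants (S # Ss) g =
    (if g = genus S then 1 else 0) + count_descendants (sons G S @ Ss) g"
  using assms card_descendants_rec[of S G g]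
  by (simp add: pending_def count_descendants_Cons count_descendants_append)


section \<open>The programs for the root and for a son\<close>

context cost_bounds
begin

lemma runs_ROOT:
  assumes "fits s" "vars s VG = G"
  shows "runs (ROOT RegT) s ((96 * G + 94) * w)
    (\<lambda>s'. fits s' \<and> vars s' VG = G \<and> get_rep RegT s' = rep_of G UNIV \<and>
      arrs s' Cnt = arrs s Cnt \<and> stack s' = stack s)"
    (is "runs _ _ _ ?Q")
proof -
  define I where "I i s' \<longleftrightarrow> vars s' VG = G \<and> vars s' VX = i \<and>
      vars s' (Fc RegT) = 0 \<and> vars s' (Fg RegT) = 0 \<and> vars s' (Fm RegT) = 1 \<and>
      arrs s' (Fd RegT) = map (\<lambda>x. if x < i then 1 + x div 2 else 0) [0..<3 * G + 1] \<and>
      arrs s' Cnt = arrs s Cnt \<and> stack s' = stack s" for i and s' :: state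
  have loop: "runs
      (FOR VX FROM Num 0 TO ThreeG DO (Fd RegT)\<langle>Var VX\<rangle> ::= Plus (Num 1) (Half (Var VX)))
      s' ((\<Sum>i=0..3 * G. 10 * w + 20 * w) + 20 * w) ?Q"
    if "fits s'" "I 0 (s'\<lparr>vars := (vars s')(VX := 0)\<rparr>)" for s'
  proof (rule runs_For[where P = I])
    show "3 * G < B"
      using B_ge by simp
    show "vars s VX = i \<and> asafe ThreeG s \<and> aval ThreeG s = 3 * G \<and>
        small (bvals (Leq (Var VX) ThreeG) s)" if "fits s" "I i s" for i s
      using that B_ge fitsD(1)[of s VX] by (auto simp: I_def small_def)
    show "?Q s" if "fits s" "I (Suc (3 * G)) s" for s
      using that by (simp add: I_def get_rep_def rep_of_def conductor_UNIV genus_UNIV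
          multiplicity_UNIV decomposition_number_UNIV)
    show "runs ((Fd RegT)\<langle>Var VX\<rangle> ::= Plus (Num 1) (Half (Var VX))) s (10 * w)
        (\<lambda>s'. fits s' \<and> vars s' VX = i \<and> I (Suc i) (s'\<lparr>vars := (vars s')(VX := Suc i)\<rparr>))"
      if "i \<le> 3 * G" "fits s" "I i s" for i s
      by (rule runs_Store)
        (use that B_ge in \<open>auto simp: I_def small_def list_eq_iff_nth_eq nth_list_update
            less_Suc_eq simp del: upt_Suc\<close>)
  qed (use that in \<open>auto simp: small_def\<close>)
  have "runs (ROOT RegT) s (10 * w + 10 * w + 10 * w + (6 * G + 14) * w
      + ((\<Sum>i=0..3 * G. 10 * w + 20 * w) + 20 * w)) ?Q"
    unfolding ROOT_def
    by (intro runs_Seq, intro runs_Assign runs_New loop)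
      (use assms B_ge in \<open>simp_all add: I_def small_def map_replicate_const
        del: upt_Suc replicate_Suc\<close>)
  then show ?thesis
    by (rule runs_mono) (simp_all add: algebra_simps)
qed

lemma runs_SON:
  assumes s: "fits s" "vars s VG = G" "vars s VX = x" "get_rep RegS s = rep_of G S"
    and S: "numerical_semigroup S" "genus S < G" and x: "irreducible_in S x" "conductor S \<le> x"
  shows "runs (SON RegS VX RegT) s ((126 * G + 114) * w)
    (\<lambda>s'. fits s' \<and> vars s' VG = G \<and> vars s' VX = x \<and> get_rep RegS s' = rep_of G S \<and>
      get_rep RegT s' = rep_of G (S - {x}) \<and> arrs s' Cnt = arrs s Cnt \<and> stack s' = stack s)"
    (is "runs _ _ _ ?Q")
proof -
  let ?d = "decomposition_number S" and ?d' = "decomposition_number (S - {x})"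
  let ?m = "if x > multiplicity S then multiplicity S else multiplicity S + 1"
  have "x \<le> 3 * G"
    using irreducible_le[OF S(1) x(1)] conductor_le_genus[OF S(1)] multiplicity_le_genus[OF S(1)] S(2)
    by linarith
  have "?m \<le> B" "genus S + 1 \<le> B" "x + 1 \<le> B"
    using multiplicity_le_genus[OF S(1)] S(2) B_ge \<open>x \<le> 3 * G\<close> by auto
  have RegS: "vars s (Fc RegS) = conductor S" "vars s (Fg RegS) = genus S"
    "vars s (Fm RegS) = multiplicity S" "arrs s (Fd RegS) = map ?d [0..<3 * G + 1]"
    using s(4) by (simp_all add: get_rep_def rep_of_def)
  have "x \<in> S"
    using x(1) by (simp add: irreducible_in_def)
  have d': "?d' y = (if x \<le> y \<and> ?d (y - x) \<noteq> 0 then ?d y - 1 else ?d y)" for y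
    unfolding decomposition_number_remove[OF \<open>x \<in> S\<close>]
    using decomposition_number_pos_iff[OF S(1), of "y - x"] by auto
  \<comment> \<open>The array of the son is correct below \<open>y\<close> and still a copy of its father's from \<open>y\<close> on.\<close>
  define I where "I y s' \<longleftrightarrow> vars s' VG = G \<and> vars s' VX = x \<and> vars s' VY = y \<and>
      get_rep RegS s' = rep_of G S \<and>
      vars s' (Fc RegT) = x + 1 \<and> vars s' (Fg RegT) = genus S + 1 \<and> vars s' (Fm RegT) = ?m \<and>
      arrs s' (Fd RegT) = map (\<lambda>i. if i < y then ?d' i else ?d i) [0..<3 * G + 1] \<and>
      arrs s' Cnt = arrs s Cnt \<and> stack s' = stack s" for y and s' :: state
  let ?body = "IF Neg (Equal (Get (Fd RegS) (Minus (Var VY) (Var VX))) (Num 0))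
        THEN (Fd RegT)\<langle>Var VY\<rangle> ::= Minus (Get (Fd RegS) (Var VY)) (Num 1)
        ELSE SKIP"
  have loop: "runs (FOR VY FROM Var VX TO ThreeG DO ?body)
      s' ((\<Sum>i=x..3 * G. 10 * w + 10 * w + 20 * w) + 20 * w) ?Q"
    if "fits s'" "vars s' VX = x" "I x (s'\<lparr>vars := (vars s')(VY := x)\<rparr>)" for s'
  proof (rule runs_For[where P = I])
    show "3 * G < B"
      using B_ge by simp
    show "vars s VY = i \<and> asafe ThreeG s \<and> aval ThreeG s = 3 * G \<and>
        small (bvals (Leq (Var VY) ThreeG) s)" if "fits s" "I i s" for i s
      using that B_ge fitsD(1)[of s VY] by (auto simp: I_def small_def)
    show "?Q s" if "fits s" "I (Suc (3 * G)) s" for s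
      using that by (simp add: I_def get_rep_def rep_of_def conductor_remove[OF S(1) x(2)]
          genus_remove[OF S(1) x(1)] multiplicity_remove[OF S(1) x])
    show "runs ?body s (10 * w + 10 * w)
        (\<lambda>s'. fits s' \<and> vars s' VY = y \<and> I (Suc y) (s'\<lparr>vars := (vars s')(VY := Suc y)\<rparr>))"
      if y: "x \<le> y" "y \<le> 3 * G" "fits s" "I y s" for y s
    proof -
      have I: "vars s VG = G" "vars s VX = x" "vars s VY = y" "get_rep RegS s = rep_of G S"
        "arrs s (Fd RegT) = map (\<lambda>i. if i < y then ?d' i else ?d i) [0..<3 * G + 1]"
        using y(4) by (simp_all add: I_def)
      then have d: "arrs s (Fd RegS) = map ?d [0..<3 * G + 1]"
        by (simp add: get_rep_def rep_of_def)
      have d_le: "?d i \<le> B" if "i \<le> 3 * G" for i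
        using decomposition_number_le[of S i] that B_ge by linarith
      have nth: "map ?d [0..<3 * G + 1] ! i = ?d i" if "i \<le> 3 * G" for i
        using that by (simp del: upt_Suc)
      show ?thesis
      proof (rule runs_If)
        show "small (bvals (Neg (Equal (Get (Fd RegS) (Minus (Var VY) (Var VX))) (Num 0))) s)"
          using y I d d_le[of "y - x"] B_ge nth[of "y - x"] by (simp add: small_def del: upt_Suc)
        show "runs ((Fd RegT)\<langle>Var VY\<rangle> ::= Minus (Get (Fd RegS) (Var VY)) (Num 1)) s (10 * w)
          (\<lambda>s'. fits s' \<and> vars s' VY = y \<and> I (Suc y) (s'\<lparr>vars := (vars s')(VY := Suc y)\<rparr>))"
          if "bval (Neg (Equal (Get (Fd RegS) (Minus (Var VY) (Var VX))) (Num 0))) s"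
        proof (rule runs_Store)
          have "?d' y = ?d y - 1"
            using that y(1,2) by (simp add: d' I d nth del: upt_Suc)
          then have "(map (\<lambda>i. if i < y then ?d' i else ?d i) [0..<3 * G + 1])[y := ?d y - 1]
              = map (\<lambda>i. if i < Suc y then ?d' i else ?d i) [0..<3 * G + 1]"
            using y(2) by (intro nth_equalityI) (auto simp: nth_list_update less_Suc_eq simp del: upt_Suc)
          then show "fits s' \<and> vars s' VY = y \<and> I (Suc y) (s'\<lparr>vars := (vars s')(VY := Suc y)\<rparr>)"
            if "s' = s\<lparr>arrs := (arrs s)(Fd RegT := (arrs s (Fd RegT))
              [aval (Var VY) s := aval (Minus (Get (Fd RegS) (Var VY)) (Num 1)) s])\<rparr>" "fits s'" for s'
            using that y by (simp add: I_def d nth get_rep_def del: upt_Suc)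
        qed (use y I d d_le[of y] nth[of y] B_ge in \<open>simp_all add: small_def del: upt_Suc\<close>)
        show "runs SKIP s (10 * w)
          (\<lambda>s'. fits s' \<and> vars s' VY = y \<and> I (Suc y) (s'\<lparr>vars := (vars s')(VY := Suc y)\<rparr>))"
          if "\<not> bval (Neg (Equal (Get (Fd RegS) (Minus (Var VY) (Var VX))) (Num 0))) s"
        proof (rule runs_SKIP)
          have "?d' y = ?d y"
            using that y(1,2) by (simp add: d' I d nth del: upt_Suc)
          then have "map (\<lambda>i. if i < y then ?d' i else ?d i) [0..<3 * G + 1]
              = map (\<lambda>i. if i < Suc y then ?d' i else ?d i) [0..<3 * G + 1]"
            by (auto simp: less_Suc_eq)
          then show "fits s \<and> vars s VY = y \<and> I (Suc y) (s\<lparr>vars := (vars s)(VY := Suc y)\<rparr>)"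
            using y by (simp add: I_def get_rep_def del: upt_Suc)
        qed (rule y)
      qed (use y I d in \<open>simp_all del: upt_Suc\<close>)
    qed
  qed (use that \<open>x \<le> 3 * G\<close> B_ge in \<open>simp_all add: small_def\<close>)
  have d'_below: "?d' i = ?d i" if "i < x" for i
    using that by (simp add: d')
  have "runs (SON RegS VX RegT) s (10 * w + 10 * w + (10 * w + 10 * w) + (6 * G + 14) * w
      + ((\<Sum>i=x..3 * G. 10 * w + 10 * w + 20 * w) + 20 * w)) ?Q"
    unfolding SON_def
    by (intro runs_Seq, intro runs_Assign runs_If runs_Copy loop)
      (use s RegS \<open>?m \<le> B\<close> \<open>genus S + 1 \<le> B\<close> \<open>x + 1 \<le> B\<close> B_ge in
        \<open>auto simp: I_def small_def get_rep_def d'_below simp del: upt_Suc split: if_splits\<close>)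
  moreover have "(3 * G + 1 - x) * (40 * w) \<le> (3 * G + 1) * (40 * w)"
    by (intro mult_right_mono) simp_all
  ultimately show ?thesis
    by (elim runs_mono) (simp_all add: algebra_simps)
qed

end


section \<open>The traversal\<close>

lemma COUNT_eq:
  "COUNT =
     New Cnt (Plus (Var VG) (Num 1));;
     ClearStack;;
     ROOT RegT;;
     Push RegT;;
     WHILE Neg StackEmpty DO VISIT"
  by (simp add: COUNT_def VISIT_def)

context cost_bounds
begin

text \<open>
  \<open>son_time\<close> covers the construction and the push of one son, and also the initial work up to the push
  of the root. \<open>visit_time\<close> covers the work on a popped semigroup apart from its sons.
\<close>

definition son_time :: nat where
  "son_time = 140 * (G + 1) * w"

definition visit_time :: nat where
  "visit_time = 90 * (G + 1) * w + 10 * wK"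

lemma runs_push_sons:
  assumes s: "fits s" "vars s VG = G" "get_rep RegS s = rep_of G S" "stack s = Rs"
    and S: "numerical_semigroup S" "genus S < G" and height: "length Rs + G < B"
  shows "runs
      (FOR VX FROM Var (Fc RegS) TO Plus (Var (Fc RegS)) (Var (Fm RegS)) DO
          (IF Conj (Neg (Equal (Var VX) (Num 0))) (Equal (Get (Fd RegS) (Var VX)) (Num 1))
           THEN SON RegS VX RegT;; Push RegT
           ELSE SKIP))
      s (30 * (G + 1) * w + 20 * w + length (sons G S) * son_time)
      (\<lambda>s'. fits s' \<and> vars s' VG = G \<and> arrs s' Cnt = arrs s Cnt \<and>
        stack s' = map (rep_of G) (sons G S) @ Rs)"
    (is "runs (FOR VX FROM _ TO ?e DO ?body) _ _ ?Q")
proof -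
  let ?c = "conductor S" and ?m = "multiplicity S" and ?d = "decomposition_number S"
  let ?P = "\<lambda>x. x \<noteq> 0 \<and> ?d x = 1"
  let ?pushed = "\<lambda>i. map (rep_of G) (rev (map (\<lambda>x. S - {x}) (filter ?P [?c..<i]))) @ Rs"
  have m: "?m \<le> G"
    using multiplicity_le_genus[OF S(1)] S(2) by simp
  have cm: "?c + ?m < 3 * G"
    using multiplicity_le_genus[OF S(1)] conductor_le_genus[OF S(1)] S(2) by linarith
  define I where "I i s' \<longleftrightarrow> vars s' VG = G \<and> vars s' VX = i \<and> get_rep RegS s' = rep_of G S \<and>
      arrs s' Cnt = arrs s Cnt \<and> stack s' = ?pushed i" for i and s' :: state
  have RegS: "vars s (Fc RegS) = ?c" "vars s (Fm RegS) = ?m"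
    "arrs s (Fd RegS) = map ?d [0..<3 * G + 1]" if "get_rep RegS s = rep_of G S" for s
    using that by (simp_all add: get_rep_def rep_of_def)
  have "runs (FOR VX FROM Var (Fc RegS) TO ?e DO ?body) s
      ((\<Sum>i=?c..?c + ?m. 10 * w + (if ?P i then son_time else 0) + 20 * w) + 20 * w) ?Q"
  proof (rule runs_For[where P = I])
    show "?c + ?m < B"
      using cm B_ge by simp
    show "vars s VX = i \<and> asafe ?e s \<and> aval ?e s = ?c + ?m \<and> small (bvals (Leq (Var VX) ?e) s)"
      if "fits s" "I i s" for i s
      using that cm B_ge fitsD(1)[of s VX] by (auto simp: I_def RegS small_def)
    show "?Q s" if "fits s" "I (Suc (?c + ?m)) s" for s
      using that S(2) by (simp add: I_def sons_def effective_generators_def)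
    show "I ?c (s\<lparr>vars := (vars s)(VX := ?c)\<rparr>)"
      using s by (simp add: I_def get_rep_def)
    show "runs ?body s (10 * w + (if ?P i then son_time else 0))
        (\<lambda>s'. fits s' \<and> vars s' VX = i \<and> I (Suc i) (s'\<lparr>vars := (vars s')(VX := Suc i)\<rparr>))"
      if i: "?c \<le> i" "i \<le> ?c + ?m" and s: "fits s" "I i s" for i s
    proof -
      have I: "vars s VG = G" "vars s VX = i" "get_rep RegS s = rep_of G S"
        using s(2) by (simp_all add: I_def)
      have d: "arrs s (Fd RegS) ! i = ?d i" "i < length (arrs s (Fd RegS))"
        using i(2) cm by (simp_all add: RegS[OF I(3)] del: upt_Suc)
      then have "?d i \<le> B"
        using fits_nth[OF s(1), of i RegS] by simp
      have step: "filter ?P [?c..<Suc i] = filter ?P [?c..<i] @ (if ?P i then [i] else [])"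
        using i(1) by simp
      show ?thesis
      proof (rule runs_If)
        assume "bval (Conj (Neg (Equal (Var VX) (Num 0))) (Equal (Get (Fd RegS) (Var VX)) (Num 1))) s"
        then have "?P i"
          using I d by simp
        then have irr: "irreducible_in S i"
          using decomposition_number_eq_1_iff[OF S(1)] by blast
        have "length (filter ?P [?c..<i]) \<le> i - ?c"
          using length_filter_le[of ?P "[?c..<i]"] by simp
        then have "length (stack s) < B"
          using i height m s(2) by (simp add: I_def)
        have "runs (SON RegS VX RegT;; Push RegT) s ((126 * G + 114) * w + (6 * G + 14) * w)
          (\<lambda>s'. fits s' \<and> vars s' VX = i \<and> I (Suc i) (s'\<lparr>vars := (vars s')(VX := Suc i)\<rparr>))"
        proof (rule runs_Seq, rule runs_mono[OF runs_SON[OF s(1) I S irr i(1)] order_refl], elim conjE)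
          fix s' assume s': "fits s'" "vars s' VG = G" "vars s' VX = i" "get_rep RegS s' = rep_of G S"
            "get_rep RegT s' = rep_of G (S - {i})" "arrs s' Cnt = arrs s Cnt" "stack s' = stack s"
          show "runs (Push RegT) s' ((6 * G + 14) * w)
            (\<lambda>s'. fits s' \<and> vars s' VX = i \<and> I (Suc i) (s'\<lparr>vars := (vars s')(VX := Suc i)\<rparr>))"
          proof (rule runs_Push)
            show "fits s'' \<and> vars s'' VX = i \<and> I (Suc i) (s''\<lparr>vars := (vars s'')(VX := Suc i)\<rparr>)"
              if "s'' = s'\<lparr>stack := get_rep RegT s' # stack s'\<rparr>" "fits s''" for s''
              using that s' s(2) \<open>?P i\<close> unfolding I_def step by (simp add: get_rep_def)
          qed (use s' \<open>length (stack s) < B\<close> in simp_all)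
        qed
        then show "runs (SON RegS VX RegT;; Push RegT) s (if ?P i then son_time else 0)
          (\<lambda>s'. fits s' \<and> vars s' VX = i \<and> I (Suc i) (s'\<lparr>vars := (vars s')(VX := Suc i)\<rparr>))"
          by (rule runs_mono) (use \<open>?P i\<close> in \<open>simp_all add: son_time_def algebra_simps\<close>)
      next
        assume "\<not> bval (Conj (Neg (Equal (Var VX) (Num 0))) (Equal (Get (Fd RegS) (Var VX)) (Num 1))) s"
        then have "\<not> ?P i"
          using I d by simp
        then show "runs SKIP s (if ?P i then son_time else 0)
          (\<lambda>s'. fits s' \<and> vars s' VX = i \<and> I (Suc i) (s'\<lparr>vars := (vars s')(VX := Suc i)\<rparr>))"
          using s unfolding I_def step by (intro runs_SKIP) (simp_all add: get_rep_def)
      qed (use s(1) I d \<open>?d i \<le> B\<close> i(2) cm B_ge in \<open>simp_all add: small_def\<close>)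
    qed
  qed (use s(1) cm B_ge RegS[OF s(3)] in \<open>simp_all add: small_def\<close>)
  moreover have "(\<Sum>i=?c..?c + ?m. if ?P i then son_time else 0) = length (sons G S) * son_time"
  proof -
    have "(\<Sum>i=?c..?c + ?m. if ?P i then son_time else 0)
        = (\<Sum>i\<in>set [?c..<Suc (?c + ?m)]. if ?P i then son_time else 0)"
      by (intro sum.cong) auto
    also have "\<dots> = (\<Sum>i\<leftarrow>effective_generators S. son_time)"
      unfolding sum_set_upt_conv_sum_list_nat effective_generators_def sum_list_map_filter' ..
    finally show ?thesis
      using S(2) by (simp add: sum_list_triv sons_def)
  qed
  moreover have "(?m + 1) * (30 * w) \<le> (G + 1) * (30 * w)"
    using m by (intro mult_right_mono) simp_all
  ultimately show ?thesis
    by (elim runs_mono) (simp_all add: sum.distrib algebra_simps)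
qed

lemma runs_VISIT:
  assumes s: "fits s" "vars s VG = G" "stack s = rep_of G S # Rs"
    and S: "numerical_semigroup S" "genus S \<le> G"
    and Cnt: "length (arrs s Cnt) = G + 1" "arrs s Cnt ! genus S < K"
    and height: "length Rs + G < B"
  shows "runs VISIT s (visit_time + length (sons G S) * son_time)
    (\<lambda>s'. fits s' \<and> vars s' VG = G \<and> stack s' = map (rep_of G) (sons G S) @ Rs \<and>
      arrs s' Cnt = (arrs s Cnt)[genus S := Suc (arrs s Cnt ! genus S)])"
    (is "runs _ _ _ ?Q")
proof -
  let ?for = "FOR VX FROM Var (Fc RegS) TO Plus (Var (Fc RegS)) (Var (Fm RegS)) DO
          (IF Conj (Neg (Equal (Var VX) (Num 0))) (Equal (Get (Fd RegS) (Var VX)) (Num 1))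
           THEN SON RegS VX RegT;; Push RegT
           ELSE SKIP)"
  let ?t = "30 * (G + 1) * w + 20 * w + length (sons G S) * son_time"
  have if_son: "runs (IF Neg (Leq (Var VG) (Var (Fg RegS))) THEN ?for ELSE SKIP) s' (10 * w + ?t) ?Q"
    if s': "fits s'" "vars s' VG = G" "get_rep RegS s' = rep_of G S" "stack s' = Rs"
      "arrs s' Cnt = (arrs s Cnt)[genus S := Suc (arrs s Cnt ! genus S)]" for s'
  proof (rule runs_If)
    have Fg: "vars s' (Fg RegS) = genus S"
      using s'(3) by (simp add: get_rep_def rep_of_def)
    show "runs ?for s' ?t ?Q" if "bval (Neg (Leq (Var VG) (Var (Fg RegS)))) s'"
    proof -
      have "genus S < G"
        using that Fg s'(2) by simp
      from runs_push_sons[OF s'(1-4) S(1) this height] show ?thesis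
        by (rule runs_mono) (simp_all add: s'(5))
    qed
    show "runs SKIP s' ?t ?Q" if "\<not> bval (Neg (Leq (Var VG) (Var (Fg RegS)))) s'"
      using that Fg s' by (intro runs_SKIP) (simp_all add: sons_def)
  qed (use s'(1,2) fitsD(1)[OF s'(1)] B_ge in \<open>simp_all add: small_def\<close>)
  have "runs VISIT s ((6 * G + 14) * w + 10 * (w + wK) + (10 * w + ?t)) ?Q"
    unfolding VISIT_def
    by (intro runs_Seq, rule runs_Pop[OF s(1,3)], intro runs_increment_Cnt if_son)
      (use s(2) S(2) Cnt in \<open>simp_all add: set_rep_def get_rep_def rep_of_def\<close>)
  then show ?thesis
    by (rule runs_mono) (simp_all add: visit_time_def algebra_simps)
qed

text \<open>
  Every semigroup visited from now on is charged for its visit, for one test of the stack and for its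
  construction. The semigroups already on the stack have been constructed before, which is the credit
  \<open>length Ss * son_time\<close> on the right-hand side of the time bound. With this credit the charges of a
  popped semigroup and of the subtrees of its sons add up exactly. The bound by \<open>K\<close> speaks of the
  final values of the counters, so that it is invariant.
\<close>

lemma runs_traversal:
  assumes "pending G Ss" "fits s" "vars s VG = G" "stack s = map (rep_of G) Ss"
    and "length (arrs s Cnt) = G + 1"
    and "\<And>g. g \<le> G \<Longrightarrow> arrs s Cnt ! g + count_descendants Ss g \<le> K"
    and "(\<Sum>g\<le>G. count_descendants Ss g) * (son_time + visit_time + 10 * w) + 10 * w
      \<le> T + length Ss * son_time"
  shows "runs (WHILE Neg StackEmpty DO VISIT) s T
    (\<lambda>s'. length (arrs s' Cnt) = G + 1 \<and>
      (\<forall>g\<le>G. arrs s' Cnt ! g = arrs s Cnt ! g + count_descendants Ss g))"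
  using assms
proof (induction "\<Sum>g\<le>G. count_descendants Ss g" arbitrary: Ss s T rule: less_induct)
  case less
  have height: "length Ss \<le> (G + 1) * (G + 1)"
    using less.prems(1) by (rule pending_length_le)
  then have safe: "small (bvals (Neg StackEmpty) s)"
    using less.prems(4) by (simp add: small_def B_def)
  show ?case
  proof (cases Ss)
    case Nil
    have "runs (WHILE Neg StackEmpty DO VISIT) s (10 * w)
      (\<lambda>s'. length (arrs s' Cnt) = G + 1 \<and>
        (\<forall>g\<le>G. arrs s' Cnt ! g = arrs s Cnt ! g + count_descendants Ss g))"
      using less.prems safe Nil
      by (intro runs_While_False) (simp_all add: count_descendants_Nil)
    then show ?thesis
      by (rule runs_mono) (use less.prems(7) Nil in \<open>simp_all add: count_descendants_Nil\<close>)
  next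
    case (Cons S Rs)
    have S: "numerical_semigroup S" "genus S \<le> G"
      using less.prems(1) Cons by (simp_all add: pending_def)
    let ?Ss' = "sons G S @ Rs" and ?u = "son_time + visit_time + 10 * w"
    let ?N = "\<lambda>Ss. \<Sum>g\<le>G. count_descendants Ss g"
    have pending': "pending G ?Ss'"
      using less.prems(1) pending_step Cons by blast
    have count: "count_descendants Ss g = (if g = genus S then 1 else 0) + count_descendants ?Ss' g"
      if "g \<le> G" for g
      using count_descendants_step less.prems(1) that unfolding Cons by blast
    have total: "?N Ss = Suc (?N ?Ss')"
      using S(2) by (simp add: count sum.distrib)
    \<comment> \<open>The truncated difference is a true one, since each pending semigroup is still to be counted.\<close>
    define T' where "T' = ?N ?Ss' * ?u + 10 * w - length ?Ss' * son_time"
    have "length ?Ss' * son_time \<le> ?N ?Ss' * ?u"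
      using pending_length_le_count[OF pending'] by (intro mult_mono) auto
    then have T': "?N ?Ss' * ?u + 10 * w = T' + length ?Ss' * son_time"
      by (simp add: T'_def)
    have "runs (WHILE Neg StackEmpty DO VISIT) s
      (10 * w + (visit_time + length (sons G S) * son_time) + T')
      (\<lambda>s'. length (arrs s' Cnt) = G + 1 \<and>
        (\<forall>g\<le>G. arrs s' Cnt ! g = arrs s Cnt ! g + count_descendants Ss g))"
    proof (rule runs_While_True)
      have visit: "runs VISIT s (visit_time + length (sons G S) * son_time)
        (\<lambda>s'. fits s' \<and> vars s' VG = G \<and>
          stack s' = map (rep_of G) (sons G S) @ map (rep_of G) Rs \<and>
          arrs s' Cnt = (arrs s Cnt)[genus S := Suc (arrs s Cnt ! genus S)])"
        using less.prems Cons S height count[OF S(2)] less.prems(6)[OF S(2)]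
        by (intro runs_VISIT) (simp_all add: B_def)
      show "runs VISIT s (visit_time + length (sons G S) * son_time)
        (\<lambda>s'. runs (WHILE Neg StackEmpty DO VISIT) s' T'
          (\<lambda>s'. length (arrs s' Cnt) = G + 1 \<and>
            (\<forall>g\<le>G. arrs s' Cnt ! g = arrs s Cnt ! g + count_descendants Ss g)))"
      proof (rule runs_mono[OF visit order_refl], elim conjE)
        fix s' assume s': "fits s'" "vars s' VG = G"
          "stack s' = map (rep_of G) (sons G S) @ map (rep_of G) Rs"
          "arrs s' Cnt = (arrs s Cnt)[genus S := Suc (arrs s Cnt ! genus S)]"
        have Cnt: "arrs s' Cnt ! g + count_descendants ?Ss' g = arrs s Cnt ! g + count_descendants Ss g"
          if "g \<le> G" for g
          using that less.prems(5) count[OF that] by (auto simp: s'(4) nth_list_update)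
        have "runs (WHILE Neg StackEmpty DO VISIT) s' T'
          (\<lambda>s''. length (arrs s'' Cnt) = G + 1 \<and>
            (\<forall>g\<le>G. arrs s'' Cnt ! g = arrs s' Cnt ! g + count_descendants ?Ss' g))"
        proof (rule less.hyps[OF _ pending' s'(1,2)])
          show "?N ?Ss' < ?N Ss"
            using total by simp
          show "arrs s' Cnt ! g + count_descendants ?Ss' g \<le> K" if "g \<le> G" for g
            using less.prems(6)[OF that] Cnt[OF that] by simp
        qed (use s' less.prems(5) T' in simp_all)
        then show "runs (WHILE Neg StackEmpty DO VISIT) s' T'
          (\<lambda>s''. length (arrs s'' Cnt) = G + 1 \<and>
            (\<forall>g\<le>G. arrs s'' Cnt ! g = arrs s Cnt ! g + count_descendants Ss g))"
          by (rule runs_mono) (use Cnt in simp_all)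
      qed
    qed (use less.prems(2,4) safe Cons in simp_all)
    then show ?thesis
    proof (rule runs_mono)
      have "Suc (?N ?Ss') * ?u + 10 * w \<le> T + Suc (length Rs) * son_time"
        using less.prems(7) unfolding total by (simp add: Cons)
      then show "10 * w + (visit_time + length (sons G S) * son_time) + T' \<le> T"
        using T' by (simp add: algebra_simps)
    qed
  qed
qed

lemma runs_COUNT:
  assumes "\<And>g. g \<le> G \<Longrightarrow> num_semigroups g \<le> K"
  shows "runs COUNT (init_state G)
    ((\<Sum>g\<le>G. num_semigroups g) * (240 * (G + 1) * w + 10 * wK) + 10 * w)
    (\<lambda>s. length (arrs s Cnt) = G + 1 \<and> (\<forall>g\<le>G. arrs s Cnt ! g = num_semigroups g))"
    (is "runs _ _ _ ?Q")
proof -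
  let ?loop = "WHILE Neg StackEmpty DO VISIT" and ?u = "son_time + visit_time + 10 * w"
  let ?N = "\<Sum>g\<le>G. num_semigroups g"
  have count: "count_descendants [UNIV] g = num_semigroups g" for g
    by (simp add: count_descendants_def descendants_UNIV)
  have "1 \<le> ?N"
    using pending_length_le_count[OF pending_UNIV] by (simp add: count)
  then have "1 * ?u \<le> ?N * ?u"
    by (rule mult_right_mono) simp
  then have "son_time \<le> ?N * ?u + 10 * w"
    by (intro trans_le_add1) (rule order_trans[rotated], assumption, simp)
  \<comment> \<open>The root is on the stack when the loop starts; its construction is paid for by the initial part.\<close>
  define T where "T = ?N * ?u + 10 * w - son_time"
  have T: "?N * ?u + 10 * w = T + son_time"
    unfolding T_def using \<open>son_time \<le> ?N * ?u + 10 * w\<close> by (rule le_add_diff_inverse2[symmetric])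
  have loop: "runs ?loop s T ?Q"
    if "fits s" "vars s VG = G" "stack s = [rep_of G UNIV]" "arrs s Cnt = replicate (G + 1) 0" for s
    using that assms T
    by (intro runs_mono[OF runs_traversal[OF pending_UNIV] order_refl])
      (simp_all add: count del: replicate_Suc)
  have main: "runs (ROOT RegT) s ((96 * G + 94) * w)
      (\<lambda>s'. runs (Push RegT) s' ((6 * G + 14) * w) (\<lambda>s'. runs ?loop s' T ?Q))"
    if "fits s" "vars s VG = G" "stack s = []" "arrs s Cnt = replicate (G + 1) 0" for s
  proof (rule runs_mono[OF runs_ROOT[OF that(1,2)] order_refl], elim conjE)
    fix s' assume s': "fits s'" "vars s' VG = G" "get_rep RegT s' = rep_of G UNIV"
      "arrs s' Cnt = arrs s Cnt" "stack s' = stack s"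
    show "runs (Push RegT) s' ((6 * G + 14) * w) (\<lambda>s'. runs ?loop s' T ?Q)"
      using s' that B_ge by (intro runs_Push loop) simp_all
  qed
  have init: "fits (init_state G)"
    using B_ge by (simp add: fits_def init_state_def)
  have "runs COUNT (init_state G)
      ((6 * G + 14) * w + 10 * w + (96 * G + 94) * w + (6 * G + 14) * w + T) ?Q"
    unfolding COUNT_eq
    by (intro runs_Seq, intro runs_New runs_ClearStack main)
      (use init B_ge in \<open>simp_all add: init_state_def small_def del: replicate_Suc\<close>)
  moreover have "(6 * G + 14) * w + 10 * w + (96 * G + 94) * w + (6 * G + 14) * w + T
      \<le> ?N * (240 * (G + 1) * w + 10 * wK) + 10 * w"
  proof -
    have "?N * ?u \<le> ?N * (240 * (G + 1) * w + 10 * wK)"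
      by (intro mult_left_mono) (simp_all add: son_time_def visit_time_def algebra_simps)
    moreover have "(6 * G + 14) * w + 10 * w + (96 * G + 94) * w + (6 * G + 14) * w \<le> son_time"
      by (simp add: son_time_def algebra_simps)
    ultimately show ?thesis
      using T by linarith
  qed
  ultimately show ?thesis
    by (rule runs_mono)
qed

lemma max_mem_le: "max_mem \<le> 40 * (G + 1) ^ 3 * w + 11 * (G + 1) * wK"
proof -
  have "B * (3 * G + 4) + (6 * G + 22) \<le> 40 * (G + 1) ^ 3"
    by (simp add: B_def power3_eq_cube algebra_simps)
  then have "(B * (3 * G + 4) + (6 * G + 22)) * w \<le> 40 * (G + 1) ^ 3 * w"
    by (rule mult_right_mono) simp
  then show ?thesis
    by (simp add: max_mem_def algebra_simps)
qed

end


section \<open>Asymptotics\<close>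

lemma exec_COUNT:
  assumes w: "\<And>n. n \<le> (G + 1) * (G + 2) \<Longrightarrow> tc n \<le> w \<and> sc n \<le> w"
    and wK: "\<And>n. n \<le> 4 ^ G \<Longrightarrow> tc n \<le> wK \<and> sc n \<le> wK"
  shows "\<exists>t m s. exec tc sc COUNT (init_state G) t m s \<and> length (arrs s Cnt) = G + 1 \<and>
    (\<forall>g\<le>G. arrs s Cnt ! g = num_semigroups g) \<and>
    t \<le> (\<Sum>g\<le>G. num_semigroups g) * (240 * (G + 1) * w + 10 * wK) + 10 * w \<and>
    m \<le> 40 * (G + 1) ^ 3 * w + 11 * (G + 1) * wK"
proof -
  interpret cost_bounds tc sc G "4 ^ G" w wK
    using w wK by unfold_locales auto
  have "num_semigroups g \<le> 4 ^ G" if "g \<le> G" for g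
    using num_semigroups_le[of g] power_increasing[OF that, of "4 :: nat"] by linarith
  from runs_COUNT[OF this] show ?thesis
    unfolding runs_def using max_mem_le by (meson order_trans)
qed

text \<open>
  The additive constant absorbs the finitely many arguments at which the asymptotic bound need not hold.
  The case \<open>n = 0\<close> fits because \<open>ln 0 = 0\<close>.
\<close>

lemma bigo_lnE:
  fixes f :: "nat \<Rightarrow> nat"
  assumes "(\<lambda>n. real (f n)) \<in> O(\<lambda>n. ln (real n))"
  obtains c d where "0 \<le> c" "0 \<le> d" "\<And>n. real (f n) \<le> c * ln (real n) + d"
proof -
  obtain c where c: "0 < c" "eventually (\<lambda>n. norm (real (f n)) \<le> c * norm (ln (real n))) sequentially"
    using landau_o.bigE[OF assms] by blast
  then obtain N where N: "\<And>n. N \<le> n \<Longrightarrow> real (f n) \<le> c * \<bar>ln (real n)\<bar>"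
    by (auto simp: eventually_sequentially)
  have abs: "\<bar>ln (real n)\<bar> = ln (real n)" for n
    by (cases n) auto
  define d where "d = real (\<Sum>k<N. f k)"
  have "real (f n) \<le> c * ln (real n) + d" for n
  proof (cases "N \<le> n")
    case True
    have "0 \<le> d"
      unfolding d_def by (rule of_nat_0_le_iff)
    with N[OF True] show ?thesis
      unfolding abs by simp
  next
    case False
    then have "f n \<le> (\<Sum>k<N. f k)"
      by (intro member_le_sum) auto
    then have "real (f n) \<le> d"
      unfolding d_def by (rule of_nat_mono)
    moreover have "0 \<le> c * ln (real n)"
      using c(1) abs[of n] by (metis abs_ge_zero less_eq_real_def mult_nonneg_nonneg)
    ultimately show ?thesis
      by simp
  qed
  moreover have "0 \<le> d"
    unfolding d_def by (rule of_nat_0_le_iff)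
  ultimately show ?thesis
    using c(1) by (intro that[of c d]) simp_all
qed

lemma ln_mono_nat: "n \<le> m \<Longrightarrow> 1 \<le> m \<Longrightarrow> ln (real n) \<le> ln (real m)"
  by (cases n) auto

theorem proposition3p3:
  fixes tc sc :: "nat \<Rightarrow> nat"
  assumes "(\<lambda>n. real (tc n)) \<in> O(\<lambda>n. ln (real n))"
    and "(\<lambda>n. real (sc n)) \<in> O(\<lambda>n. ln (real n))"
  shows "\<exists>time space :: nat \<Rightarrow> nat.
    (\<forall>G. \<exists>s. exec tc sc COUNT (init_state G) (time G) (space G) s \<and>
             length (arrs s Cnt) = G + 1 \<and>
             (\<forall>g\<le>G. arrs s Cnt ! g = num_semigroups g)) \<and>
    (\<lambda>G. real (time G)) \<in>
      O(\<lambda>G. ln (real G) * real G * (\<Sum>g=0..G. real (num_semigroups g))) \<and>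
    (\<lambda>G. real (space G)) \<in> O(\<lambda>G. ln (real G) * real G ^ 3)"
proof -
  obtain c1 d1 where tc: "0 \<le> c1" "0 \<le> d1" "\<And>n. real (tc n) \<le> c1 * ln (real n) + d1"
    using bigo_lnE[OF assms(1)] by blast
  obtain c2 d2 where sc: "0 \<le> c2" "0 \<le> d2" "\<And>n. real (sc n) \<le> c2 * ln (real n) + d2"
    using bigo_lnE[OF assms(2)] by blast
  define c d where "c = c1 + c2" and "d = d1 + d2"
  have "0 \<le> c" "0 \<le> d"
    using tc sc by (simp_all add: c_def d_def)
  define W where "W m = nat \<lceil>c * ln (real m) + d\<rceil>" for m :: nat
  have W_real: "real (W m) \<le> c * ln (real m) + d + 1" if "1 \<le> m" for m
  proof -
    have "0 \<le> c * ln (real m) + d"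
      using that \<open>0 \<le> c\<close> \<open>0 \<le> d\<close> by simp
    then show ?thesis
      unfolding W_def by linarith
  qed
  have W: "tc n \<le> W m \<and> sc n \<le> W m" if "n \<le> m" "1 \<le> m" for n m
  proof -
    have "c1 * ln (real n) \<le> c1 * ln (real m)" "c2 * ln (real n) \<le> c2 * ln (real m)"
      using tc(1) sc(1) ln_mono_nat[OF that] by (auto intro: mult_left_mono)
    moreover have "0 \<le> c1 * ln (real m)" "0 \<le> c2 * ln (real m)"
      using tc(1) sc(1) that(2) by simp_all
    ultimately have "real (tc n) \<le> c * ln (real m) + d" "real (sc n) \<le> c * ln (real m) + d"
      using tc(2) tc(3)[of n] sc(2) sc(3)[of n] by (simp_all add: c_def d_def algebra_simps)
    then show ?thesis
      unfolding W_def by linarith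
  qed
  define w wK where "w G = W ((G + 1) * (G + 2))" and "wK G = W (4 ^ G)" for G
  define N where "N G = (\<Sum>g\<le>G. num_semigroups g)" for G
  have "\<forall>G. \<exists>t m s. exec tc sc COUNT (init_state G) t m s \<and> length (arrs s Cnt) = G + 1 \<and>
    (\<forall>g\<le>G. arrs s Cnt ! g = num_semigroups g) \<and>
    t \<le> N G * (240 * (G + 1) * w G + 10 * wK G) + 10 * w G \<and>
    m \<le> 40 * (G + 1) ^ 3 * w G + 11 * (G + 1) * wK G"
    unfolding w_def wK_def N_def using W by (intro allI exec_COUNT) simp_all
  then obtain time space where run: "\<And>G. \<exists>s. exec tc sc COUNT (init_state G) (time G) (space G) s \<and>
      length (arrs s Cnt) = G + 1 \<and> (\<forall>g\<le>G. arrs s Cnt ! g = num_semigroups g)"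
    and time: "\<And>G. time G \<le> N G * (240 * (G + 1) * w G + 10 * wK G) + 10 * w G"
    and space: "\<And>G. space G \<le> 40 * (G + 1) ^ 3 * w G + 11 * (G + 1) * wK G"
    by metis
  \<comment> \<open>The factor 4 comes from \<open>(G + 1) * (G + 2) \<le> G ^ 4\<close> and from \<open>ln (4 ^ G) \<le> 4 * G\<close>. For \<open>3 \<le> G\<close> both
    \<open>ln G\<close> and \<open>G\<close> are at least 1 and absorb the additive constants.\<close>
  define C where "C = 4 * c + d + 1"
  have "0 \<le> C"
    using \<open>0 \<le> c\<close> \<open>0 \<le> d\<close> by (simp add: C_def)
  have ln_ge: "1 \<le> ln (real G)" if "3 \<le> G" for G
    using that exp_le by (subst ln_ge_iff) auto
  have w_le: "real (w G) \<le> C * ln (real G)" if "3 \<le> G" for G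
  proof -
    have "(G + 1) * (G + 2) \<le> (G * G) * (G * G)"
      using that by (intro mult_mono) (auto intro: order_trans[OF _ mult_le_mono1[OF that]])
    then have "(G + 1) * (G + 2) \<le> G ^ 4"
      by (simp add: power4_eq_xxxx mult.assoc)
    then have "ln (real ((G + 1) * (G + 2))) \<le> ln (real (G ^ 4))"
      using that by (intro ln_mono_nat) simp_all
    also have "\<dots> = 4 * ln (real G)"
      using that by (simp add: ln_realpow)
    finally have "c * ln (real ((G + 1) * (G + 2))) \<le> c * (4 * ln (real G))"
      using \<open>0 \<le> c\<close> by (rule mult_left_mono)
    moreover have "(d + 1) * 1 \<le> (d + 1) * ln (real G)"
      using \<open>0 \<le> d\<close> ln_ge[OF that] by (intro mult_left_mono) simp_all
    ultimately show ?thesis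
      using W_real[of "(G + 1) * (G + 2)"] by (simp add: w_def C_def algebra_simps)
  qed
  have wK_le: "real (wK G) \<le> C * real G" if "3 \<le> G" for G
  proof -
    have "ln (real (4 ^ G)) = real G * ln 4"
      by (simp add: ln_realpow)
    also have "\<dots> \<le> real G * 4"
      using ln_le_minus_one[of "4 :: real"] by (intro mult_left_mono) simp_all
    finally have "c * ln (real (4 ^ G)) \<le> c * (real G * 4)"
      using \<open>0 \<le> c\<close> by (rule mult_left_mono)
    moreover have "(d + 1) * 1 \<le> (d + 1) * real G"
      using \<open>0 \<le> d\<close> that by (intro mult_left_mono) simp_all
    ultimately show ?thesis
      using W_real[of "4 ^ G"] by (simp add: wK_def C_def algebra_simps)
  qed
  have "real (time G) \<le> 500 * C * (ln (real G) * real G * real (N G))" if "3 \<le> G" for G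
  proof -
    let ?L = "ln (real G)"
    have "1 \<le> N G"
      using sum_mono2[of "{..G}" "{0}" num_semigroups] card_descendants_le_genus[OF numerical_semigroup_UNIV, of 0]
      by (simp add: N_def descendants_UNIV genus_UNIV)
    have "real (G + 1) * real (w G) \<le> (2 * real G) * (C * ?L)"
      using that w_le[OF that] by (intro mult_mono) simp_all
    moreover have "C * real G * 1 \<le> C * real G * ?L" "C * ?L * 1 \<le> C * ?L * real G"
      using that ln_ge[OF that] \<open>0 \<le> C\<close>
      by (intro mult_left_mono mult_nonneg_nonneg; simp)+
    ultimately have "240 * (real (G + 1) * real (w G)) + 10 * real (wK G) + 10 * real (w G)
        \<le> 500 * (C * ?L * real G)"
      using w_le[OF that] wK_le[OF that] by (simp add: algebra_simps)
    then have "real (N G) * (240 * (real (G + 1) * real (w G)) + 10 * real (wK G) + 10 * real (w G))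
        \<le> real (N G) * (500 * (C * ?L * real G))"
      by (rule mult_left_mono) simp
    moreover have "1 * (10 * real (w G)) \<le> real (N G) * (10 * real (w G))"
      using \<open>1 \<le> N G\<close> by (intro mult_right_mono) simp_all
    moreover have "real (time G) \<le> real (N G * (240 * (G + 1) * w G + 10 * wK G) + 10 * w G)"
      using time by (rule of_nat_mono)
    ultimately show ?thesis
      by (simp add: algebra_simps)
  qed
  moreover have "(\<Sum>g=0..G. real (num_semigroups g)) = real (N G)" for G
    by (simp add: N_def atMost_atLeast0)
  ultimately have time_O: "(\<lambda>G. real (time G)) \<in>
      O(\<lambda>G. ln (real G) * real G * (\<Sum>g=0..G. real (num_semigroups g)))"
    by (intro bigoI[of _ "500 * C"] eventually_sequentiallyI[of 3]) (simp add: abs_mult)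
  have "real (space G) \<le> 342 * C * (ln (real G) * real G ^ 3)" if "3 \<le> G" for G
  proof -
    let ?L = "ln (real G)"
    have "real (G + 1) ^ 3 \<le> (2 * real G) ^ 3"
      using that by (intro power_mono) simp_all
    then have "real (G + 1) ^ 3 * real (w G) \<le> (2 * real G) ^ 3 * (C * ?L)"
      using w_le[OF that] by (intro mult_mono) simp_all
    moreover have "real (G + 1) * real (wK G) \<le> (2 * real G) * (C * real G)"
      using that wK_le[OF that] by (intro mult_mono) simp_all
    moreover have "real G ^ 2 * C * (1 * 1) \<le> real G ^ 2 * C * (real G * ?L)"
      using that ln_ge[OF that] \<open>0 \<le> C\<close> by (intro mult_left_mono mult_mono) simp_all
    moreover have "real (space G) \<le> real (40 * (G + 1) ^ 3 * w G + 11 * (G + 1) * wK G)"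
      using space by (rule of_nat_mono)
    ultimately show ?thesis
      by (simp add: algebra_simps power2_eq_square power3_eq_cube)
  qed
  then have space_O: "(\<lambda>G. real (space G)) \<in> O(\<lambda>G. ln (real G) * real G ^ 3)"
    by (intro bigoI[of _ "342 * C"] eventually_sequentiallyI[of 3]) (simp add: abs_mult)
  show ?thesis
    by (rule exI[of _ time], rule exI[of _ space]) (intro conjI allI run time_O space_O)
qed

end
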